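(* Let $X,Y$ be compact Hausdorff spaces and let $E,F$ be Banach spaces over $\mathbb K$. Let $A(X,E)$ be a subspace of $C(X,E)$ containing all constant functions, let $A(X)$ be a regular Banach function algebra on $X$ such that $A(X)\cdot A(X,E)\subseteq A(X,E)$, and let $(A(X,E),\|\cdot\|_\infty)$ have property (P). Let $T,S:A(X,E)\to C(Y,F)$ be jointly separating linear operators, and let $Y_1,Y_c,Y_d$ be the subsets of $Y$ associated with $T,S$ as defined in the context. Then there exist a continuous map $\phi:Y_c\cup Y_d\to X$ and maps $\Lambda^T,\Lambda^S:Y_c\to L(E,F_w)$, $y\mapsto\Lambda^T_y$, $y\mapsto\Lambda^S_y$, such that for each $f\in A(X,E)$ and each $y\in Y_c$ $$Tf(y)=\Lambda^T_y\big(f(\phi(y))\big)\quad\text{and}\quad Sf(y)=\Lambda^S_y\big(f(\phi(y))\big).$$ In particular, if $T$ and $S$ are continuous (with respect to the supremum norms), then $Y_d=\emptyset$, $Y_c=Y_1$, and $\Lambda^T$ and $\Lambda^S$ take their values in $L(E,F)$. If, in addition, the ranges of $T$ and $S$ contain all constant functions, then $Y_c=Y$.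
   Context: $\mathbb K$ is $\mathbb R$ or $\mathbb C$. $C(X,E)$ is the space of all continuous functions $X\to E$ with the supremum norm $\|\cdot\|_\infty$. For a function $f$, $\mathrm{coz}(f)=\{x: f(x)\neq 0\}$. $F_w$ is $F$ with its weak topology; $L(E,F)$ and $L(E,F_w)$ are the spaces of continuous linear operators from $E$ (with its norm topology) to $F$ and to $F_w$, respectively. $\delta_y$ is evaluation at $y$. A Banach function algebra on $X$ is a complex subalgebra $A(X)$ of the algebra of continuous complex-valued functions on $X$ that contains the constants, separates the points of $X$, and is a Banach algebra under some norm $\|\cdot\|_{A(X)}$. It is regular if for every closed subset $K$ of its maximal ideal space and every $\varphi\notin K$ in the maximal ideal space there is $f\in A(X)$ whose Gelfand transform satisfies $\widehat f(\varphi)=1$ and $\widehat f=0$ on $K$. $A(X)\cdot A(X,E)=\{f\cdot h:f\in A(X),h\in A(X,E)\}$, where $(f\cdot h)(x)=f(x)h(x)$. Property (P) for $(A(X,E),\|\cdot\|)$, where $\|\cdot\|\ge\|\cdot\|_\infty$: for each $f\in A(X,E)$ and $x\in X$ with $f(x)=0$ there is a sequence $\{f_n\}$ in $A(X,E)$ such that each $f_n$ vanishes on a neighborhood of $x$ and $\|f_n-f\|\to0$. Linear operators $T,S:A(X,E)\to C(Y,F)$ are jointly separating if $\mathrm{coz}(Tf)\cap\mathrm{coz}(Sg)=\emptyset$ for all $f,g\in A(X,E)$ with $\mathrm{coz}(f)\cap\mathrm{coz}(g)=\emptyset$. For such a pair, $$Y_1=\Big(\bigcup_{f\in A(X,E)}\mathrm{coz}(Tf)\Big)\cap\Big(\bigcup_{f\in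 A(X,E)}\mathrm{coz}(Sf)\Big),$$ $$Y_c=\{y\in Y_1:\ \delta_y\circ T,\ \delta_y\circ S:(A(X,E),\|\cdot\|_\infty)\to F_w\text{ are continuous}\},$$ and $Y_d=Y_1\setminus Y_c$.
   Formalization: For K = R, where products of complex-valued functions with E-valued ones are undefined for a real space E, A(X) is taken to be a real Banach algebra of real-valued functions; the last claim Y_c = Y assumes F ≠ {0}, since it fails for F = {0}. *)

theory Defs
  imports "HOL-Analysis.Analysis"
begin

text \<open>
  The scalar field is a set \<open>K\<close> of complex numbers, either \<open>\<real>\<close> or \<open>UNIV\<close>.  A Banach space over
  \<open>K\<close> is a type of class \<open>banach\<close> (a real Banach space) together with a scalar multiplication
  \<open>sc\<close>, of which only the values \<open>sc c x\<close> with \<open>c \<in> K\<close> matter.  For a compact space \<open>X\<close>, the space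
  \<open>C(X,E)\<close> with the supremum norm is the library type \<open>'x \<Rightarrow>\<^sub>C 'e\<close>.
\<close>

definition banach_space_over :: "complex set \<Rightarrow> (complex \<Rightarrow> 'e::banach \<Rightarrow> 'e) \<Rightarrow> bool" where
  "banach_space_over K sc \<longleftrightarrow>
     (\<forall>c\<in>K. \<forall>x y. sc c (x + y) = sc c x + sc c y) \<and>
     (\<forall>c\<in>K. \<forall>d\<in>K. \<forall>x. sc (c + d) x = sc c x + sc d x) \<and>
     (\<forall>c\<in>K. \<forall>d\<in>K. \<forall>x. sc c (sc d x) = sc (c * d) x) \<and>
     (\<forall>r x. sc (of_real r) x = r *\<^sub>R x) \<and>
     (\<forall>c\<in>K. \<forall>x. norm (sc c x) = cmod c * norm x)"

definition linear_over ::
    "complex set \<Rightarrow> (complex \<Rightarrow> 'v::ab_group_add \<Rightarrow> 'v) \<Rightarrow> (complex \<Rightarrow> 'w::ab_group_add \<Rightarrow> 'w) \<Rightarrow>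
     'v set \<Rightarrow> ('v \<Rightarrow> 'w) \<Rightarrow> bool" where
  "linear_over K scV scW V L \<longleftrightarrow>
     (\<forall>u\<in>V. \<forall>v\<in>V. L (u + v) = L u + L v) \<and>
     (\<forall>c\<in>K. \<forall>v\<in>V. L (scV c v) = scW c (L v))"

definition subspace_over ::
    "complex set \<Rightarrow> (complex \<Rightarrow> 'v::ab_group_add \<Rightarrow> 'v) \<Rightarrow> 'v set \<Rightarrow> bool" where
  "subspace_over K sc V \<longleftrightarrow>
     0 \<in> V \<and> (\<forall>u\<in>V. \<forall>v\<in>V. u + v \<in> V) \<and> (\<forall>c\<in>K. \<forall>v\<in>V. sc c v \<in> V)"

text \<open>The pointwise product \<open>x \<mapsto> f(x) h(x)\<close> of a scalar-valued and a vector-valued function, and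
  the induced scalar multiplication on \<open>C(X,E)\<close>.\<close>

definition bcf_mult ::
    "(complex \<Rightarrow> 'e \<Rightarrow> 'e) \<Rightarrow> ('x::topological_space \<Rightarrow>\<^sub>C complex) \<Rightarrow> ('x \<Rightarrow>\<^sub>C 'e::real_normed_vector)
     \<Rightarrow> ('x \<Rightarrow>\<^sub>C 'e)" where
  "bcf_mult sc f h = Bcontfun (\<lambda>x. sc (f x) (h x))"

definition bcf_scale ::
    "(complex \<Rightarrow> 'e \<Rightarrow> 'e) \<Rightarrow> complex \<Rightarrow> ('x::topological_space \<Rightarrow>\<^sub>C 'e::real_normed_vector)
     \<Rightarrow> ('x \<Rightarrow>\<^sub>C 'e)" where
  "bcf_scale sc c h = bcf_mult sc (const_bcontfun c) h"

lemma banach_space_over_complex: "banach_space_over K ((*) :: complex \<Rightarrow> complex \<Rightarrow> complex)"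
  by (simp add: banach_space_over_def algebra_simps norm_mult scaleR_conv_of_real)

lemma banach_space_over_scaleR: "banach_space_over \<real> (\<lambda>c x. Re c *\<^sub>R x)"
  by (auto simp: banach_space_over_def scaleR_add_right scaleR_add_left Reals_def)

lemma apply_bcf_mult:
  assumes K: "K = \<real> \<or> K = UNIV" and sc: "banach_space_over K sc"
    and f: "range (apply_bcontfun f) \<subseteq> K"
  shows "apply_bcontfun (bcf_mult sc f h) x = sc (f x) (h x)"
proof -
  have fK: "f x \<in> K" for x using f by auto
  have Kdiff: "c - d \<in> K" if "c \<in> K" "d \<in> K" for c d using K that by auto
  have add_left: "sc (c + d) v = sc c v + sc d v" if "c \<in> K" "d \<in> K" for c d v
    using sc that unfolding banach_space_over_def by blast
  have add_right: "sc c (u + v) = sc c u + sc c v" if "c \<in> K" for c u v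
    using sc that unfolding banach_space_over_def by blast
  have diff_left: "sc c v - sc d v = sc (c - d) v" if "c \<in> K" "d \<in> K" for c d v
    using add_left[of "c - d" d v] Kdiff[OF that] that by simp
  have diff_right: "sc c u - sc c v = sc c (u - v)" if "c \<in> K" for c u v
    using add_right[of c "u - v" v] that by simp
  have nrm: "norm (sc c v) = cmod c * norm v" if "c \<in> K" for c v
    using sc that unfolding banach_space_over_def by blast
  have est: "norm (sc (f y) (h y) - sc (f x) (h x))
      \<le> cmod (f y) * norm (h y - h x) + cmod (f y - f x) * norm (h x)" for x y
  proof -
    have "sc (f y) (h y) - sc (f x) (h x) = sc (f y) (h y - h x) + sc (f y - f x) (h x)"
      by (simp add: diff_left[OF fK fK, symmetric] diff_right[OF fK, symmetric])
    then have "norm (sc (f y) (h y) - sc (f x) (h x))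
        \<le> norm (sc (f y) (h y - h x)) + norm (sc (f y - f x) (h x))"
      by (simp add: norm_triangle_ineq)
    then show ?thesis using nrm[OF fK] nrm[OF Kdiff[OF fK fK]] by simp
  qed
  have "((\<lambda>y. sc (f y) (h y)) \<longlongrightarrow> sc (f x) (h x)) (at x)" for x
  proof -
    have cf: "((\<lambda>y. f y) \<longlongrightarrow> f x) (at x)" and ch: "((\<lambda>y. h y) \<longlongrightarrow> h x) (at x)"
      using continuous_on_apply_bcontfun[of UNIV f] continuous_on_apply_bcontfun[of UNIV h]
      by (auto simp: continuous_on_def)
    have "((\<lambda>y. cmod (f y) * norm (h y - h x) + cmod (f y - f x) * norm (h x)) \<longlongrightarrow>
        cmod (f x) * norm (h x - h x) + cmod (f x - f x) * norm (h x)) (at x)"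
      by (intro tendsto_intros cf ch)
    then have "((\<lambda>y. cmod (f y) * norm (h y - h x) + cmod (f y - f x) * norm (h x)) \<longlongrightarrow> 0) (at x)"
      by simp
    then have "((\<lambda>y. sc (f y) (h y) - sc (f x) (h x)) \<longlongrightarrow> 0) (at x)"
      by (rule Lim_null_comparison[rotated]) (simp add: est)
    then show ?thesis by (simp add: LIM_zero_iff)
  qed
  then have "continuous_on UNIV (\<lambda>y. sc (f y) (h y))"
    by (simp add: continuous_on_def)
  moreover have "bounded (range (\<lambda>y. sc (f y) (h y)))"
  proof -
    have "norm (sc (f y) (h y)) \<le> norm f * norm h" for y
      unfolding nrm[OF fK] by (intro mult_mono norm_bounded) auto
    then show ?thesis by (auto simp: bounded_iff)
  qed
  ultimately show ?thesis
    by (simp add: bcf_mult_def bcontfun_def Bcontfun_inverse)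
qed

text \<open>The weak topology of a Banach space over \<open>K\<close>, generated by its continuous \<open>K\<close>-linear
  functionals.\<close>

definition dual_over :: "complex set \<Rightarrow> (complex \<Rightarrow> 'f::banach \<Rightarrow> 'f) \<Rightarrow> ('f \<Rightarrow> complex) set" where
  "dual_over K sc =
     {l. linear_over K sc (*) UNIV l \<and> range l \<subseteq> K \<and> continuous_on UNIV l}"

definition weak_topology :: "complex set \<Rightarrow> (complex \<Rightarrow> 'f::banach \<Rightarrow> 'f) \<Rightarrow> 'f topology" where
  "weak_topology K sc = topology_generated_by {l -` U | l U. l \<in> dual_over K sc \<and> open U}"

text \<open>\<open>L(E,F)\<close> for \<open>\<tau> = euclidean\<close> and \<open>L(E,F\<^sub>w)\<close> for \<open>\<tau> = weak_topology K scF\<close>.\<close>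

definition cont_linear_ops ::
    "complex set \<Rightarrow> (complex \<Rightarrow> 'e::banach \<Rightarrow> 'e) \<Rightarrow> (complex \<Rightarrow> 'f::banach \<Rightarrow> 'f) \<Rightarrow> 'f topology \<Rightarrow>
     ('e \<Rightarrow> 'f) set" where
  "cont_linear_ops K scE scF \<tau> =
     {L. linear_over K scE scF UNIV L \<and> continuous_map euclidean \<tau> L}"

text \<open>For \<open>K = UNIV\<close> this is a (complex) Banach function algebra; for \<open>K = \<real>\<close> it is its real
  counterpart, a real algebra of real-valued functions.\<close>

definition banach_function_algebra ::
    "complex set \<Rightarrow> ('x::topological_space \<Rightarrow>\<^sub>C complex) set \<Rightarrow> bool" where
  "banach_function_algebra K A \<longleftrightarrow>
     (\<forall>f\<in>A. range (apply_bcontfun f) \<subseteq> K) \<and>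
     subspace_over K (bcf_scale (*)) A \<and>
     (\<forall>f\<in>A. \<forall>g\<in>A. bcf_mult (*) f g \<in> A) \<and>
     (\<forall>c\<in>K. const_bcontfun c \<in> A) \<and>
     (\<forall>x y. x \<noteq> y \<longrightarrow> (\<exists>f\<in>A. apply_bcontfun f x \<noteq> apply_bcontfun f y)) \<and>
     (\<exists>N :: ('x \<Rightarrow>\<^sub>C complex) \<Rightarrow> real.
        (\<forall>f\<in>A. 0 \<le> N f \<and> (N f = 0 \<longleftrightarrow> f = 0)) \<and>
        (\<forall>f\<in>A. \<forall>g\<in>A. N (f + g) \<le> N f + N g) \<and>
        (\<forall>c\<in>K. \<forall>f\<in>A. N (bcf_scale (*) c f) = cmod c * N f) \<and>
        (\<forall>f\<in>A. \<forall>g\<in>A. N (bcf_mult (*) f g) \<le> N f * N g) \<and>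
        (\<forall>u :: nat \<Rightarrow> ('x \<Rightarrow>\<^sub>C complex).
           (\<forall>n. u n \<in> A) \<and> (\<forall>e>0. \<exists>M. \<forall>m\<ge>M. \<forall>n\<ge>M. N (u m - u n) < e) \<longrightarrow>
           (\<exists>f\<in>A. (\<lambda>n. N (u n - f)) \<longlonglongrightarrow> 0)))"

text \<open>Maximal ideals are represented by characters, i.e. nonzero \<open>K\<close>-linear multiplicative
  functionals into the complex numbers (also for \<open>K = \<real>\<close>), made extensional outside the algebra;
  the Gelfand topology is that of pointwise convergence on the algebra.\<close>

definition characters ::
    "complex set \<Rightarrow> ('x::topological_space \<Rightarrow>\<^sub>C complex) set \<Rightarrow> (('x \<Rightarrow>\<^sub>C complex) \<Rightarrow> complex) set" where
  "characters K A =
     {\<psi> \<in> extensional A.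
        linear_over K (bcf_scale (*)) (*) A \<psi> \<and>
        (\<forall>f\<in>A. \<forall>g\<in>A. \<psi> (bcf_mult (*) f g) = \<psi> f * \<psi> g) \<and>
        (\<exists>f\<in>A. \<psi> f \<noteq> 0)}"

definition maximal_ideal_space ::
    "complex set \<Rightarrow> ('x::topological_space \<Rightarrow>\<^sub>C complex) set \<Rightarrow>
     (('x \<Rightarrow>\<^sub>C complex) \<Rightarrow> complex) topology" where
  "maximal_ideal_space K A =
     subtopology (product_topology (\<lambda>_. euclidean) A) (characters K A)"

definition gelfand ::
    "('x::topological_space \<Rightarrow>\<^sub>C complex) \<Rightarrow> (('x \<Rightarrow>\<^sub>C complex) \<Rightarrow> complex) \<Rightarrow> complex" where
  "gelfand f \<psi> = \<psi> f"

definition regular_algebra ::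
    "complex set \<Rightarrow> ('x::topological_space \<Rightarrow>\<^sub>C complex) set \<Rightarrow> bool" where
  "regular_algebra K A \<longleftrightarrow>
     (\<forall>C \<psi>. closedin (maximal_ideal_space K A) C \<and>
        \<psi> \<in> topspace (maximal_ideal_space K A) \<and> \<psi> \<notin> C \<longrightarrow>
        (\<exists>f\<in>A. gelfand f \<psi> = 1 \<and> (\<forall>\<omega>\<in>C. gelfand f \<omega> = 0)))"

definition coz :: "('x \<Rightarrow> 'e::zero) \<Rightarrow> 'x set" where
  "coz f = {x. f x \<noteq> 0}"

definition property_P ::
    "(('x::topological_space \<Rightarrow>\<^sub>C 'e::real_normed_vector) \<Rightarrow> real) \<Rightarrow> ('x \<Rightarrow>\<^sub>C 'e) set \<Rightarrow> bool" where
  "property_P N A \<longleftrightarrow>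
     (\<forall>f\<in>A. \<forall>x. apply_bcontfun f x = 0 \<longrightarrow>
        (\<exists>u :: nat \<Rightarrow> ('x \<Rightarrow>\<^sub>C 'e).
           (\<forall>n. u n \<in> A \<and> (\<exists>U. open U \<and> x \<in> U \<and> (\<forall>z\<in>U. apply_bcontfun (u n) z = 0))) \<and>
           (\<lambda>n. N (u n - f)) \<longlonglongrightarrow> 0))"

definition jointly_separating ::
    "('x::topological_space \<Rightarrow>\<^sub>C 'e::real_normed_vector) set \<Rightarrow>
     (('x \<Rightarrow>\<^sub>C 'e) \<Rightarrow> ('y::topological_space \<Rightarrow>\<^sub>C 'f::real_normed_vector)) \<Rightarrow>
     (('x \<Rightarrow>\<^sub>C 'e) \<Rightarrow> ('y \<Rightarrow>\<^sub>C 'f)) \<Rightarrow> bool" where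
  "jointly_separating A T S \<longleftrightarrow>
     (\<forall>f\<in>A. \<forall>g\<in>A. coz (apply_bcontfun f) \<inter> coz (apply_bcontfun g) = {} \<longrightarrow>
        coz (apply_bcontfun (T f)) \<inter> coz (apply_bcontfun (S g)) = {})"

definition Y1 ::
    "('x::topological_space \<Rightarrow>\<^sub>C 'e::real_normed_vector) set \<Rightarrow>
     (('x \<Rightarrow>\<^sub>C 'e) \<Rightarrow> ('y::topological_space \<Rightarrow>\<^sub>C 'f::real_normed_vector)) \<Rightarrow>
     (('x \<Rightarrow>\<^sub>C 'e) \<Rightarrow> ('y \<Rightarrow>\<^sub>C 'f)) \<Rightarrow> 'y set" where
  "Y1 A T S = (\<Union>f\<in>A. coz (apply_bcontfun (T f))) \<inter> (\<Union>f\<in>A. coz (apply_bcontfun (S f)))"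

definition Yc ::
    "complex set \<Rightarrow> (complex \<Rightarrow> 'f \<Rightarrow> 'f) \<Rightarrow>
     ('x::topological_space \<Rightarrow>\<^sub>C 'e::real_normed_vector) set \<Rightarrow>
     (('x \<Rightarrow>\<^sub>C 'e) \<Rightarrow> ('y::topological_space \<Rightarrow>\<^sub>C 'f::banach)) \<Rightarrow>
     (('x \<Rightarrow>\<^sub>C 'e) \<Rightarrow> ('y \<Rightarrow>\<^sub>C 'f)) \<Rightarrow> 'y set" where
  "Yc K scF A T S =
     {y \<in> Y1 A T S.
        continuous_map (top_of_set A) (weak_topology K scF) (\<lambda>f. apply_bcontfun (T f) y) \<and>
        continuous_map (top_of_set A) (weak_topology K scF) (\<lambda>f. apply_bcontfun (S f) y)}"

definition Yd ::
    "complex set \<Rightarrow> (complex \<Rightarrow> 'f \<Rightarrow> 'f) \<Rightarrow>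
     ('x::topological_space \<Rightarrow>\<^sub>C 'e::real_normed_vector) set \<Rightarrow>
     (('x \<Rightarrow>\<^sub>C 'e) \<Rightarrow> ('y::topological_space \<Rightarrow>\<^sub>C 'f::banach)) \<Rightarrow>
     (('x \<Rightarrow>\<^sub>C 'e) \<Rightarrow> ('y \<Rightarrow>\<^sub>C 'f)) \<Rightarrow> 'y set" where
  "Yd K scF A T S = Y1 A T S - Yc K scF A T S"

end

theory Submission
  imports Defs "HOL-Library.Function_Algebras"
begin

text \<open>
  For \<open>y \<in> Y\<^sub>1\<close> the functions \<open>f \<in> A(X)\<close> with \<open>T(f h)(y) = 0\<close> for all \<open>h\<close> form a proper ideal
  of \<open>A(X)\<close>. By the Gelfand-Mazur theorem a proper ideal lies in the kernel of a character, and by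
  regularity every character is the evaluation at a point of \<open>X\<close> (a function vanishing on \<open>X\<close> is
  zero, so no character lies outside the closed set of evaluations). Hence the ideal has a common
  zero; joint separation and regularity show that it is the same point \<open>\<phi>(y)\<close> for \<open>T\<close> and \<open>S\<close>,
  and that \<open>Tf(y) = Sf(y) = 0\<close> whenever \<open>f\<close> vanishes near \<open>\<phi>(y)\<close>. If \<open>y \<in> Y\<^sub>c\<close>, then property (P)
  and weak continuity extend this to all \<open>f\<close> with \<open>f(\<phi>(y)) = 0\<close>, because the dual of \<open>F\<close> separates
  points; applying it to \<open>f\<close> minus the constant \<open>f(\<phi>(y))\<close> gives the representation.
\<close>

subsection \<open>Functionals separating the points of a Banach space\<close>

text \<open>The ideal is taken in \<open>A(X)\<close> because only there is a multiplication; the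
  module condition carries its products back to \<open>A(X,E)\<close>. The detour through characters
  has a reason: a proper ideal of functions may fail to have a common zero, as the kernel of a
  character other than a point evaluation shows. This is also where the complete norm of
  \<open>A(X)\<close> enters, while property (P) concerns the supremum norm. Over the reals a Banach
  field may be a copy of the complex numbers, so real algebras have to be complexified first. No
  quotient algebra is formed: its norm becomes a seminorm on the original ring, and identities in
  the quotient become identities up to an element of seminorm 0. The point \<open>\<phi>(y)\<close>
  is found from cozero sets and the algebra alone, without any continuity of \<open>T\<close> or
  \<open>S\<close>; hence \<open>\<phi>\<close> lives on \<open>Yd\<close> as well, and only the
  formula for the operators is confined to \<open>Yc\<close>.\<close>

definition sublinear :: "('a::real_vector \<Rightarrow> real) \<Rightarrow> bool" where
  "sublinear p \<longleftrightarrow> (\<forall>x y. p (x + y) \<le> p x + p y) \<and> (\<forall>c x. 0 \<le> c \<longrightarrow> p (c *\<^sub>R x) = c * p x)"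

lemma sublinear_add: "sublinear p \<Longrightarrow> p (x + y) \<le> p x + p y"
  by (simp add: sublinear_def)

lemma sublinear_scale: "sublinear p \<Longrightarrow> 0 \<le> c \<Longrightarrow> p (c *\<^sub>R x) = c * p x"
  by (simp add: sublinear_def)

lemma sublinear_zero: "sublinear p \<Longrightarrow> p 0 = 0"
  using sublinear_scale[of p 0 0] by simp

lemma sublinear_neg: "sublinear p \<Longrightarrow> - p (- x) \<le> p x"
  using sublinear_add[of p x "- x"] sublinear_zero[of p] by simp

text \<open>One inequality for positive scalars is enough: applied to \<open>inverse c\<close> and
  \<open>c *\<^sub>R x\<close> it gives the reverse one.\<close>

lemma sublinearI:
  assumes "\<And>x y. p (x + y) \<le> p x + p y" and "\<And>c x. 0 < c \<Longrightarrow> p (c *\<^sub>R x) \<le> c * p x" and "p 0 = 0"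
  shows "sublinear p"
  unfolding sublinear_def
proof (intro conjI allI impI)
  fix c :: real and x :: 'a assume c: "0 \<le> c"
  show "p (c *\<^sub>R x) = c * p x"
  proof (cases "c = 0")
    case False
    then have c: "c > 0" using c by simp
    have "p (inverse c *\<^sub>R c *\<^sub>R x) \<le> inverse c * p (c *\<^sub>R x)"
      by (rule assms(2)) (simp add: c)
    then have "c * p x \<le> p (c *\<^sub>R x)" using c by (simp add: field_simps)
    then show ?thesis using assms(2)[OF c, of x] by simp
  qed (simp add: assms(3))
qed (rule assms(1))

text \<open>A minimal sublinear \<open>p\<close> agrees with \<open>ray_inf p v\<close> for every \<open>v\<close>, which forces additivity.\<close>

definition ray_inf :: "('a::real_vector \<Rightarrow> real) \<Rightarrow> 'a \<Rightarrow> 'a \<Rightarrow> real" where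
  "ray_inf p v x = (INF t\<in>{0..}. p (x + t *\<^sub>R v) - t * p v)"

context
  fixes p :: "'a::real_vector \<Rightarrow> real" and v :: 'a
  assumes p: "sublinear p"
begin

lemma ray_inf_bdd: "bdd_below ((\<lambda>t. p (x + t *\<^sub>R v) - t * p v) ` {0..})"
proof (rule bdd_belowI2)
  fix t :: real assume "t \<in> {0..}"
  then show "- p (- x) \<le> p (x + t *\<^sub>R v) - t * p v"
    using sublinear_add[OF p, of "- x" "x + t *\<^sub>R v"] sublinear_scale[OF p, of t v] by simp
qed

lemma ray_inf_le: "0 \<le> t \<Longrightarrow> ray_inf p v x \<le> p (x + t *\<^sub>R v) - t * p v"
  unfolding ray_inf_def by (rule cINF_lower[OF ray_inf_bdd]) simp

lemma ray_inf_greatest: "(\<And>t. 0 \<le> t \<Longrightarrow> b \<le> p (x + t *\<^sub>R v) - t * p v) \<Longrightarrow> b \<le> ray_inf p v x"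
  unfolding ray_inf_def by (rule cINF_greatest) auto

lemma ray_inf_le_self: "ray_inf p v x \<le> p x"
  using ray_inf_le[of 0 x] by simp

text \<open>Parameters \<open>s\<close> for \<open>x\<close> and \<open>t\<close> for
  \<open>y\<close> combine to \<open>s + t\<close> for \<open>x + y\<close>, and scaling by
  \<open>c\<close> turns \<open>t\<close> into \<open>c * t\<close>; the half line of parameters is
  stable under both.\<close>

lemma sublinear_ray_inf: "sublinear (ray_inf p v)"
proof (rule sublinearI)
  fix x y
  have "ray_inf p v (x + y) - (p (y + t *\<^sub>R v) - t * p v) \<le> ray_inf p v x" if "0 \<le> t" for t
  proof (rule ray_inf_greatest)
    fix s :: real assume "0 \<le> s"
    then show "ray_inf p v (x + y) - (p (y + t *\<^sub>R v) - t * p v) \<le> p (x + s *\<^sub>R v) - s * p v"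
      using ray_inf_le[of "s + t" "x + y"] that sublinear_add[OF p, of "x + s *\<^sub>R v" "y + t *\<^sub>R v"]
      by (simp add: algebra_simps)
  qed
  then have "ray_inf p v (x + y) - ray_inf p v x \<le> ray_inf p v y"
    by (intro ray_inf_greatest) (smt (verit))
  then show "ray_inf p v (x + y) \<le> ray_inf p v x + ray_inf p v y" by simp
next
  fix c :: real and x assume c: "0 < c"
  have "ray_inf p v (c *\<^sub>R x) / c \<le> ray_inf p v x"
  proof (rule ray_inf_greatest)
    fix t :: real assume t: "0 \<le> t"
    have "p (c *\<^sub>R x + (c * t) *\<^sub>R v) = c * p (x + t *\<^sub>R v)"
      using sublinear_scale[OF p, of c "x + t *\<^sub>R v"] c by (simp add: algebra_simps)
    then show "ray_inf p v (c *\<^sub>R x) / c \<le> p (x + t *\<^sub>R v) - t * p v"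
      using ray_inf_le[of "c * t" "c *\<^sub>R x"] c t by (simp add: field_simps)
  qed
  then show "ray_inf p v (c *\<^sub>R x) \<le> c * ray_inf p v x" using c by (simp add: field_simps)
next
  show "ray_inf p v 0 = 0"
  proof (rule antisym)
    show "0 \<le> ray_inf p v 0"
      by (rule ray_inf_greatest) (simp add: sublinear_scale[OF p])
  qed (use ray_inf_le_self[of 0] sublinear_zero[OF p] in simp)
qed

end

text \<open>The parameter 1 in \<open>ray_inf p v x = p x\<close> gives
  \<open>p x + p v \<le> p (x + v)\<close>, the missing half of additivity.\<close>

lemma minimal_sublinear_linear:
  assumes p: "sublinear p" and min: "\<And>q. sublinear q \<Longrightarrow> (\<And>x. q x \<le> p x) \<Longrightarrow> q = p"
  shows "linear p"
proof -
  have eq: "ray_inf p v = p" for v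
    by (rule min) (simp_all add: sublinear_ray_inf ray_inf_le_self p)
  have add: "p (x + v) = p x + p v" for x v
    using ray_inf_le[OF p, of 1 v x] sublinear_add[OF p, of x v] by (simp add: eq)
  have neg: "p (- x) = - p x" for x
    using add[of x "- x"] sublinear_zero[OF p] by simp
  show ?thesis
  proof (rule linearI)
    fix c x show "p (c *\<^sub>R x) = c *\<^sub>R p x"
      using sublinear_scale[OF p, of c x] sublinear_scale[OF p, of "- c" x] neg[of "c *\<^sub>R x"]
      by (cases "0 \<le> c") auto
  qed (rule add)
qed

text \<open>A form of the Hahn-Banach theorem that avoids extension from subspaces. The order
  \<open>r\<close> is reversed, so that the maximal element supplied by Zorn's lemma is a minimal
  sublinear functional.\<close>

lemma linear_below_sublinear:
  fixes p :: "'a::real_vector \<Rightarrow> real"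
  assumes p: "sublinear p"
  obtains u where "linear u" and "\<And>x. u x \<le> p x"
proof -
  define P where "P = {q. sublinear q \<and> (\<forall>x. q x \<le> p x)}"
  define r where "r = {(q, q'). q \<in> P \<and> q' \<in> P \<and> (\<forall>x. q' x \<le> q x)}"
  have Field: "Field r = P" by (auto simp: r_def Field_def)
  have po: "Partial_order r"
    unfolding partial_order_on_def preorder_on_def Field
    by (auto simp: refl_on_def trans_def antisym_def r_def fun_eq_iff intro: order_trans order.antisym)
  have "\<exists>m\<in>Field r. \<forall>a\<in>Field r. (m, a) \<in> r \<longrightarrow> a = m"
  proof (rule Zorns_po_lemma[OF po])
    fix D assume D: "D \<in> Chains r"
    then have DP: "D \<subseteq> P" using Chains_subset[of r] by (auto simp: Chains_def r_def)
    show "\<exists>u\<in>Field r. \<forall>a\<in>D. (a, u) \<in> r"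
    proof (cases "D = {}")
      case True
      then show ?thesis unfolding Field using p by (auto simp: P_def)
    next
      case False
      define u where "u x = (INF q\<in>D. q x)" for x
      have bdd: "bdd_below ((\<lambda>q. q x) ` D)" for x
      proof (rule bdd_belowI2)
        fix q assume "q \<in> D"
        then have "sublinear q" "q (- x) \<le> p (- x)" using DP by (auto simp: P_def)
        then show "- p (- x) \<le> q x" using sublinear_neg[of q x] by linarith
      qed
      have lower: "u x \<le> q x" if "q \<in> D" for q x
        unfolding u_def using bdd that by (rule cINF_lower)
      have greatest: "b \<le> u x" if "\<And>q. q \<in> D \<Longrightarrow> b \<le> q x" for b x
        unfolding u_def using False that by (rule cINF_greatest)
      have "sublinear u"
      proof (rule sublinearI)
        fix x y
        \<comment> \<open>Comparability in the chain makes the infimum subadditive: the smaller of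
          \<open>q\<close> and \<open>q'\<close> serves both summands.\<close>
        have *: "u (x + y) \<le> q x + q' y" if qD: "q \<in> D" "q' \<in> D" for q q'
        proof -
          have "(\<forall>z. q z \<le> q' z) \<or> (\<forall>z. q' z \<le> q z)"
            using D qD by (auto simp: Chains_def r_def)
          then obtain s where "s \<in> D" "s x \<le> q x" "s y \<le> q' y"
            using qD by (metis order_refl)
          moreover have "sublinear s" using \<open>s \<in> D\<close> DP by (auto simp: P_def)
          ultimately show ?thesis
            using lower[of s "x + y"] sublinear_add[of s x y] by linarith
        qed
        have "u (x + y) - q' y \<le> u x" if "q' \<in> D" for q'
          by (rule greatest) (use * that in \<open>smt (verit)\<close>)
        then have "u (x + y) - u x \<le> u y"
          by (intro greatest) (smt (verit))
        then show "u (x + y) \<le> u x + u y" by simp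
      next
        fix c :: real and x assume c: "0 < c"
        have "u (c *\<^sub>R x) / c \<le> u x"
        proof (rule greatest)
          fix q assume q: "q \<in> D"
          then have "sublinear q" using DP by (auto simp: P_def)
          then show "u (c *\<^sub>R x) / c \<le> q x"
            using lower[OF q, of "c *\<^sub>R x"] sublinear_scale[of q c x] c by (simp add: field_simps)
        qed
        then show "u (c *\<^sub>R x) \<le> c * u x" using c by (simp add: field_simps)
      next
        have "q 0 = 0" if "q \<in> D" for q using that DP sublinear_zero by (auto simp: P_def)
        then have "(\<lambda>q. q 0) ` D = {0}" using False by force
        then show "u 0 = 0" by (simp add: u_def)
      qed
      moreover have "u x \<le> p x" for x
      proof -
        obtain q where "q \<in> D" using False by blast
        then have "u x \<le> q x" "q x \<le> p x" using lower DP by (auto simp: P_def)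
        then show ?thesis by linarith
      qed
      ultimately have "u \<in> P" by (simp add: P_def)
      then show ?thesis unfolding Field using DP lower by (auto simp: r_def)
    qed
  qed
  then obtain m where m: "m \<in> P" "\<And>a. a \<in> P \<Longrightarrow> \<forall>x. a x \<le> m x \<Longrightarrow> a = m"
    unfolding Field by (auto simp: r_def)
  have "linear m"
  proof (rule minimal_sublinear_linear)
    show "sublinear m" using m(1) by (simp add: P_def)
    fix q assume "sublinear q" and "\<And>x. q x \<le> m x"
    then show "q = m" using m(1) by (intro m(2)) (auto simp: P_def intro: order_trans)
  qed
  then show ?thesis using that m(1) by (simp add: P_def)
qed

text \<open>The bound is \<open>ray_inf norm v\<close> and not \<open>norm\<close>: its value at
  \<open>- v\<close> is at most \<open>norm 0 - norm v\<close>, so every linear functional below it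
  satisfies \<open>u v \<ge> norm v\<close>. This replaces the extension from the line spanned by
  \<open>v\<close>.\<close>

lemma exists_norming_functional:
  fixes v :: "'a::real_normed_vector"
  obtains u where "bounded_linear u" and "u v = norm v"
proof -
  have n: "sublinear (norm :: 'a \<Rightarrow> real)"
    by (simp add: sublinear_def norm_triangle_ineq)
  obtain u where u: "linear u" "\<And>x. u x \<le> ray_inf norm v x"
    using linear_below_sublinear[OF sublinear_ray_inf[OF n]] by blast
  have le: "u x \<le> norm x" for x
    using u(2)[of x] ray_inf_le_self[OF n, of v x] by linarith
  have abs_le: "\<bar>u x\<bar> \<le> norm x" for x
    using le[of x] le[of "- x"] linear_neg[OF u(1), of x] by simp
  have "bounded_linear u"
    by (rule bounded_linear_intro[where K = 1])
      (use abs_le linear_add[OF u(1)] linear_cmul[OF u(1)] in auto)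
  moreover have "u (- v) \<le> - norm v"
    using u(2)[of "- v"] ray_inf_le[OF n, of 1 v "- v"] by simp
  then have "u v = norm v"
    using le[of v] linear_neg[OF u(1), of v] by simp
  ultimately show ?thesis using that by blast
qed

lemma dual_over_separates:
  assumes K: "K = \<real> \<or> K = UNIV" and sc: "banach_space_over K sc" and v: "v \<noteq> 0"
  obtains l where "l \<in> dual_over K sc" and "l v \<noteq> 0"
proof -
  obtain u where u: "bounded_linear u" and uv: "u v = norm v"
    using exists_norming_functional by blast
  interpret bounded_linear u by (rule u)
  have cont: "continuous_on UNIV u" by (rule linear_continuous_on[OF u])
  have real: "sc (of_real r) x = r *\<^sub>R x" for r x
    using sc by (simp add: banach_space_over_def)
  show ?thesis
  proof (cases "K = UNIV")
    case False
    then have K: "K = \<real>" using K by simp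
    have "(\<lambda>x. of_real (u x)) \<in> dual_over K sc"
      unfolding dual_over_def K linear_over_def
      by (auto simp: add real scaleR intro!: continuous_intros cont elim!: Reals_cases)
    then show ?thesis by (rule that) (use uv v in simp)
  next
    case True
    have sc_add: "sc c (x + y) = sc c x + sc c y" for c x y
      using sc True by (simp add: banach_space_over_def)
    have add_sc: "sc (c + d) x = sc c x + sc d x" for c d x
      using sc True by (simp add: banach_space_over_def)
    have sc_sc: "sc c (sc d x) = sc (c * d) x" for c d x
      using sc True by (simp add: banach_space_over_def)
    have norm_sc: "norm (sc c x) = cmod c * norm x" for c x
      using sc True by (simp add: banach_space_over_def)
    have bl: "bounded_linear (sc \<i>)"
      by (rule bounded_linear_intro[where K = 1])
        (simp_all add: sc_add norm_sc sc_sc mult.commute flip: real)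
    \<comment> \<open>The complex-linear functional with real part \<open>u\<close>: such an
      \<open>l\<close> must satisfy \<open>Im (l x) = - Re (l (sc \<i> x))\<close>. As the real part
      is kept, \<open>l v\<close> is nonzero.\<close>
    define l where "l x = Complex (u x) (- u (sc \<i> x))" for x
    have "continuous_on UNIV (\<lambda>x. u (sc \<i> x))"
      by (rule linear_continuous_on[OF bounded_linear_compose[OF u bl]])
    then have "continuous_on UNIV l"
      unfolding l_def Complex_eq by (intro continuous_intros cont)
    moreover have "l (sc c x) = c * l x" for c x
    proof -
      have "c = of_real (Re c) + of_real (Im c) * \<i>" by (simp add: complex_eq_iff)
      then have 1: "sc c x = Re c *\<^sub>R x + Im c *\<^sub>R sc \<i> x"
        by (metis add_sc sc_sc real)
      have "\<i> * c = of_real (- Im c) + of_real (Re c) * \<i>" by (simp add: complex_eq_iff)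
      then have 2: "sc \<i> (sc c x) = - Im c *\<^sub>R x + Re c *\<^sub>R sc \<i> x"
        by (metis add_sc sc_sc real)
      show ?thesis
        unfolding l_def 2 unfolding 1 by (simp add: complex_eq_iff add diff scaleR)
    qed
    moreover have "l (x + y) = l x + l y" for x y
      by (simp add: l_def sc_add add complex_eq_iff)
    ultimately have "l \<in> dual_over K sc"
      by (simp add: dual_over_def linear_over_def True)
    then show ?thesis by (rule that) (use uv v in \<open>simp add: l_def complex_eq_iff\<close>)
  qed
qed

subsection \<open>The Gelfand-Mazur theorem\<close>

text \<open>For \<open>j \<noteq> 0\<close> this is a geometric sum whose ratio is an
  \<open>n\<close>-th root of unity other than 1. In \<open>gelfand_mazur\<close> it isolates the
  constant term of an average of polynomials of degree below \<open>n\<close>.\<close>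

lemma sum_root_of_unity_powers:
  assumes "j < n"
  shows "(\<Sum>k<n. (cis (2 * pi * real k / real n)) ^ j) = (if j = 0 then of_nat n else 0)"
proof (cases "j = 0")
  case False
  have n: "n > 0" using assms by simp
  define x where "x = cis (2 * pi * real j / real n)"
  have "(\<Sum>k<n. (cis (2 * pi * real k / real n)) ^ j) = (\<Sum>k<n. x ^ k)"
    by (intro sum.cong refl) (simp add: x_def Complex.DeMoivre mult_ac)
  moreover have "x ^ n = 1"
    using n by (simp add: x_def Complex.DeMoivre cis_multiple_2pi)
  moreover have "x \<noteq> 1"
  proof
    assume "x = 1"
    then have "cos (2 * pi * real j / real n) = 1" by (simp add: x_def complex_eq_iff)
    then obtain m :: int where "2 * pi * real j / real n = real_of_int m * 2 * pi"
      using cos_one_2pi_int by auto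
    then have "2 * pi * (real j / real n) = 2 * pi * real_of_int m" by (simp add: mult_ac)
    then have "real j / real n = real_of_int m" by (simp only: mult_cancel_left) simp
    moreover have "0 < real j / real n" "real j / real n < 1" using False assms by auto
    ultimately show False by simp
  qed
  ultimately show ?thesis using False by (simp add: geometric_sum)
qed simp

text \<open>With a seminorm on a carrier set, the same locale covers a Banach algebra and its
  quotient by an ideal, the latter with the same elements and the distance from the ideal as
  \<open>q\<close>. Of scalars only the bound with \<open>C\<close> is asked: the norm of the unit
  may exceed 1, and the norm used below on a complexification is not homogeneous for complex
  scalars.\<close>

locale seminormed_complex_ring =
  fixes R :: "'a::comm_ring_1 set" and \<iota> :: "complex \<Rightarrow> 'a" and q :: "'a \<Rightarrow> real" and C :: real
  assumes add_closed: "x \<in> R \<Longrightarrow> y \<in> R \<Longrightarrow> x + y \<in> R"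
    and mult_closed: "x \<in> R \<Longrightarrow> y \<in> R \<Longrightarrow> x * y \<in> R"
    and \<iota>_closed: "\<iota> c \<in> R"
    and \<iota>_add: "\<iota> (c + d) = \<iota> c + \<iota> d"
    and \<iota>_mult: "\<iota> (c * d) = \<iota> c * \<iota> d"
    and \<iota>_1: "\<iota> 1 = 1"
    and q_nonneg: "x \<in> R \<Longrightarrow> 0 \<le> q x"
    and q_add: "x \<in> R \<Longrightarrow> y \<in> R \<Longrightarrow> q (x + y) \<le> q x + q y"
    and q_uminus: "x \<in> R \<Longrightarrow> q (- x) = q x"
    and q_mult: "x \<in> R \<Longrightarrow> y \<in> R \<Longrightarrow> q (x * y) \<le> q x * q y"
    and q_\<iota>: "q (\<iota> c) \<le> C * cmod c"
begin

lemma one_closed: "1 \<in> R" using \<iota>_closed[of 1] by (simp add: \<iota>_1)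

lemma \<iota>_0: "\<iota> 0 = 0" using \<iota>_add[of 0 0] by simp

lemma \<iota>_minus: "\<iota> (- c) = - \<iota> c"
  using \<iota>_add[of c "- c"] by (simp add: \<iota>_0 add_eq_0_iff)

lemma \<iota>_diff: "\<iota> (c - d) = \<iota> c - \<iota> d"
  using \<iota>_add[of c "- d"] by (simp add: \<iota>_minus)

lemma \<iota>_power: "\<iota> (c ^ n) = \<iota> c ^ n"
  by (induction n) (simp_all add: \<iota>_1 \<iota>_mult)

lemma \<iota>_sum: "\<iota> (sum f A) = (\<Sum>x\<in>A. \<iota> (f x))"
  by (induction A rule: infinite_finite_induct) (simp_all add: \<iota>_0 \<iota>_add)

lemma zero_closed: "0 \<in> R" using \<iota>_closed[of 0] by (simp add: \<iota>_0)

lemma uminus_closed: "x \<in> R \<Longrightarrow> - x \<in> R"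
  using mult_closed[OF \<iota>_closed[of "- 1"], of x] by (simp add: \<iota>_minus \<iota>_1)

lemma diff_closed: "x \<in> R \<Longrightarrow> y \<in> R \<Longrightarrow> x - y \<in> R"
  using add_closed[of x "- y"] uminus_closed by simp

lemma power_closed: "x \<in> R \<Longrightarrow> x ^ n \<in> R"
  by (induction n) (auto intro: one_closed mult_closed)

lemma sum_closed: "(\<And>i. i \<in> A \<Longrightarrow> f i \<in> R) \<Longrightarrow> sum f A \<in> R"
  by (induction A rule: infinite_finite_induct) (auto intro: zero_closed add_closed)

lemmas closed = one_closed zero_closed \<iota>_closed add_closed mult_closed uminus_closed diff_closed
  power_closed sum_closed

lemma q_0: "q 0 = 0"
  using q_\<iota>[of 0] q_nonneg[OF zero_closed] by (simp add: \<iota>_0)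

lemma q_diff: "x \<in> R \<Longrightarrow> y \<in> R \<Longrightarrow> q (x - y) \<le> q x + q y"
  using q_add[of x "- y"] q_uminus uminus_closed by simp

lemma q_sum: "(\<And>i. i \<in> A \<Longrightarrow> f i \<in> R) \<Longrightarrow> q (sum f A) \<le> (\<Sum>i\<in>A. q (f i))"
proof (induction A rule: infinite_finite_induct)
  case (insert a A)
  then have "q (f a + sum f A) \<le> q (f a) + q (sum f A)" by (intro q_add closed) auto
  then show ?case using insert by (force intro: order_trans add_left_mono)
qed (auto simp: q_0)

lemma q_power: "x \<in> R \<Longrightarrow> 0 < n \<Longrightarrow> q (x ^ n) \<le> q x ^ n"
proof (induction n)
  case (Suc n)
  show ?case
  proof (cases "n = 0")
    case False
    have "q (x * x ^ n) \<le> q x * q (x ^ n)" using Suc.prems by (intro q_mult closed)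
    also have "\<dots> \<le> q x * q x ^ n" using Suc False by (intro mult_left_mono q_nonneg) auto
    finally show ?thesis by simp
  qed simp
qed simp

lemma q_scale: "x \<in> R \<Longrightarrow> q (\<iota> c * x) \<le> C * cmod c * q x"
  using q_mult[OF \<iota>_closed, of x c] mult_right_mono[OF q_\<iota>[of c] q_nonneg[of x]] by linarith

text \<open>The tool for computing modulo the kernel of \<open>q\<close>: the seminorm may be
  evaluated on any representative.\<close>

lemma q_cong: "x \<in> R \<Longrightarrow> y \<in> R \<Longrightarrow> q (x - y) = 0 \<Longrightarrow> q x = q y"
  using q_add[of "x - y" y] q_diff[of x "x - y"] by (simp add: closed)

lemma q_zero_add: "x \<in> R \<Longrightarrow> y \<in> R \<Longrightarrow> q x = 0 \<Longrightarrow> q y = 0 \<Longrightarrow> q (x + y) = 0"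
  using q_add[of x y] q_nonneg[of "x + y"] by (simp add: closed)

lemma q_zero_mult: "x \<in> R \<Longrightarrow> y \<in> R \<Longrightarrow> q x = 0 \<Longrightarrow> q (x * y) = 0"
  using q_mult[of x y] q_nonneg[of "x * y"] by (simp add: closed)

lemma q_one_ge: "q 1 \<noteq> 0 \<Longrightarrow> 1 \<le> q 1"
  using q_mult[of 1 1] q_nonneg[OF one_closed] by (simp add: one_closed)

lemma q_zero_sum: "(\<And>i. i \<in> A \<Longrightarrow> f i \<in> R) \<Longrightarrow> (\<And>i. i \<in> A \<Longrightarrow> q (f i) = 0) \<Longrightarrow> q (sum f A) = 0"
  using q_sum[of A f] q_nonneg[of "sum f A"] by (simp add: closed)

text \<open>Rickart's elementary proof. If \<open>1 - \<mu>a\<close> is invertible modulo the kernel of \<open>q\<close> for all \<open>\<mu>\<close>,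
  with inverse \<open>W \<mu>\<close>, then the average of \<open>W\<close> over the \<open>n\<close>-th roots of unity of radius \<open>s\<close> is the
  inverse of \<open>1 - s^n a^n\<close>. It is uniformly continuous in \<open>s\<close>, independently of \<open>n\<close>, and so
  \<open>s^n a^n\<close> becomes small for every \<open>s\<close>; this is absurd as \<open>a\<close> is invertible.\<close>

theorem gelfand_mazur:
  assumes q1: "q 1 \<noteq> 0" and inv: "\<And>x. x \<in> R \<Longrightarrow> q x \<noteq> 0 \<Longrightarrow> \<exists>y\<in>R. q (x * y - 1) = 0"
    and a: "a \<in> R"
  shows "\<exists>c. q (a - \<iota> c) = 0"
proof (rule ccontr)
  assume "\<not> ?thesis"
  then have nz: "q (a - \<iota> c) \<noteq> 0" for c by blast
  have q1: "1 \<le> q 1" by (rule q_one_ge[OF q1])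
  have C: "1 \<le> C" using q_\<iota>[of 1] q1 by (simp add: \<iota>_1)
  note closed = closed a
  have "\<exists>w\<in>R. q (w * (1 - \<iota> \<mu> * a) - 1) = 0" for \<mu>
  proof -
    have "q (1 - \<iota> \<mu> * a) \<noteq> 0"
    proof (cases "\<mu> = 0")
      case False
      have "a - \<iota> (1 / \<mu>) = (1 - \<iota> \<mu> * a) * \<iota> (- (1 / \<mu>))"
        using False by (simp add: algebra_simps \<iota>_minus flip: \<iota>_mult) (simp add: \<iota>_1 flip: \<iota>_mult mult.assoc)
      then show ?thesis using nz[of "1 / \<mu>"] q_zero_mult[of "1 - \<iota> \<mu> * a" "\<iota> (- (1 / \<mu>))"]
        by (auto intro: closed)
    qed (use q1 in \<open>simp add: \<iota>_0\<close>)
    from inv[OF _ this] show ?thesis by (auto simp: mult.commute intro: closed)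
  qed
  then obtain W where W: "\<And>\<mu>. W \<mu> \<in> R" "\<And>\<mu>. q (W \<mu> * (1 - \<iota> \<mu> * a) - 1) = 0" by metis
  note closed = closed W(1)
  define w where "w \<mu> = q (W \<mu>)" for \<mu>
  have w: "0 \<le> w \<mu>" for \<mu> unfolding w_def by (rule q_nonneg[OF W(1)])
  have resolvent: "q (W \<mu> - W \<nu>) \<le> C * q a * w \<mu> * w \<nu> * cmod (\<mu> - \<nu>)" for \<mu> \<nu>
  proof -
    let ?z = "\<iota> (\<mu> - \<nu>) * (W \<mu> * W \<nu> * a)"
    \<comment> \<open>The first resolvent identity, exact up to multiples of the two inversion
      errors, which have seminorm 0.\<close>
    have eq: "W \<mu> - W \<nu> - ?z = (W \<nu> * (1 - \<iota> \<nu> * a) - 1) * (- W \<mu>) + (W \<mu> * (1 - \<iota> \<mu> * a) - 1) * W \<nu>"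
      by (simp add: \<iota>_diff algebra_simps)
    have "q (W \<mu> - W \<nu>) = q ?z"
      by (rule q_cong, (intro closed)+, unfold eq) (intro q_zero_add q_zero_mult closed W)
    also have "\<dots> \<le> C * cmod (\<mu> - \<nu>) * q (W \<mu> * W \<nu> * a)" by (intro q_scale closed)
    also have "\<dots> \<le> C * cmod (\<mu> - \<nu>) * (w \<mu> * w \<nu> * q a)"
      using C q_mult[of "W \<mu> * W \<nu>" a] mult_right_mono[OF q_mult[of "W \<mu>" "W \<nu>"] q_nonneg[OF a]]
      by (intro mult_left_mono) (auto simp: w_def intro: closed order_trans)
    finally show ?thesis by (simp add: mult_ac)
  qed
  have w_cont: "isCont w \<nu>" for \<nu>
  proof -
    define k where "k = C * q a * w \<nu>"
    have k: "0 \<le> k" using C w[of \<nu>] q_nonneg[OF a] by (simp add: k_def)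
    have abs: "\<bar>w \<mu> - w \<nu>\<bar> \<le> k * w \<mu> * cmod (\<mu> - \<nu>)" for \<mu>
    proof -
      have "w \<mu> \<le> w \<nu> + q (W \<mu> - W \<nu>)" using q_add[of "W \<nu>" "W \<mu> - W \<nu>"] by (simp add: w_def closed)
      moreover have "w \<nu> \<le> w \<mu> + q (W \<mu> - W \<nu>)"
        using q_diff[of "W \<mu>" "W \<mu> - W \<nu>"] by (simp add: w_def closed)
      ultimately show ?thesis using resolvent[of \<mu> \<nu>] by (simp add: k_def mult_ac)
    qed
    have lim: "((\<lambda>\<mu>. k * cmod (\<mu> - \<nu>)) \<longlongrightarrow> k * cmod (\<nu> - \<nu>)) (at \<nu>)" by (intro tendsto_intros)
    \<comment> \<open>The bound \<open>abs\<close> still contains the unknown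
      \<open>w \<mu>\<close>. Where \<open>k * cmod (\<mu> - \<nu>) < 1 / 2\<close> it yields
      \<open>w \<mu> \<le> 2 * w \<nu>\<close>, and the unknown disappears.\<close>
    then have "\<forall>\<^sub>F \<mu> in at \<nu>. k * cmod (\<mu> - \<nu>) < 1 / 2"
      by (rule order_tendstoD) simp
    then have "\<forall>\<^sub>F \<mu> in at \<nu>. norm (w \<mu> - w \<nu>) \<le> 2 * w \<nu> * (k * cmod (\<mu> - \<nu>))"
    proof eventually_elim
      case (elim \<mu>)
      have "k * cmod (\<mu> - \<nu>) * w \<mu> \<le> 1 / 2 * w \<mu>" using elim w by (intro mult_right_mono) auto
      then have "w \<mu> \<le> 2 * w \<nu>" using abs[of \<mu>] by (simp add: mult_ac)
      then have "(k * cmod (\<mu> - \<nu>)) * w \<mu> \<le> (k * cmod (\<mu> - \<nu>)) * (2 * w \<nu>)"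
        using k by (intro mult_left_mono) auto
      then show ?case using abs[of \<mu>] by (simp add: mult_ac)
    qed
    moreover have "((\<lambda>\<mu>. 2 * w \<nu> * (k * cmod (\<mu> - \<nu>))) \<longlongrightarrow> 0) (at \<nu>)"
      using tendsto_mult_left[OF lim, of "2 * w \<nu>"] by simp
    ultimately have "((\<lambda>\<mu>. w \<mu> - w \<nu>) \<longlongrightarrow> 0) (at \<nu>)" by (rule Lim_null_comparison)
    then show ?thesis by (simp add: isCont_def LIM_zero_iff)
  qed

  \<comment> \<open>\<open>Sup G\<close> plays the role of the reciprocal of the spectral radius of
    \<open>a\<close>. The contradiction will be that \<open>G\<close> is bounded and contains its
    supremum, although by continuity of powers it contains a larger number with each of its
    elements.\<close>
  define G where "G = {s::real. 0 \<le> s \<and> (\<exists>n>0. q (a ^ n) * s ^ n < 1)}"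
  have G0: "0 \<in> G" by (auto simp: G_def intro!: exI[of _ 1])
  obtain b where b: "b \<in> R" "q (a * b - 1) = 0" using inv[OF a] nz[of 0] by (auto simp: \<iota>_0)
  \<comment> \<open>The inverse \<open>b\<close> bounds \<open>G\<close>:
    \<open>1 \<le> q 1 = q ((a * b) ^ n) \<le> q (a ^ n) * q b ^ n\<close>, which rules out
    \<open>q (a ^ n) * s ^ n < 1\<close> for \<open>s > q b\<close>.\<close>
  have G_le: "s \<le> q b" if sG: "s \<in> G" for s
  proof (rule ccontr)
    assume s: "\<not> s \<le> q b"
    obtain n where n: "n > 0" "q (a ^ n) * s ^ n < 1" using sG by (auto simp: G_def)
    have "q ((a * b) ^ n) \<le> q (a ^ n) * q (b ^ n)"
      unfolding power_mult_distrib by (intro q_mult closed b)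
    also have "\<dots> \<le> q (a ^ n) * q b ^ n" by (intro mult_left_mono q_power q_nonneg closed b n)
    also have "\<dots> \<le> q (a ^ n) * s ^ n"
      using s by (intro mult_left_mono power_mono q_nonneg closed b) auto
    finally have "q ((a * b) ^ n) < 1" using n by simp
    moreover have "q ((a * b) ^ n) = q 1"
    proof (rule q_cong)
      have "(a * b) ^ n - 1 = (a * b - 1) * (\<Sum>i<n. (a * b) ^ i)" by (rule power_diff_1_eq)
      then show "q ((a * b) ^ n - 1) = 0" by (simp only:) (intro q_zero_mult closed b)
    qed (intro closed b)+
    ultimately show False using q1 by simp
  qed
  then have bdd: "bdd_above G" by (auto simp: bdd_above_def)
  define \<sigma> where "\<sigma> = Sup G"
  have le\<sigma>: "s \<le> \<sigma>" if "s \<in> G" for s unfolding \<sigma>_def using that bdd by (rule cSup_upper)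
  have \<sigma>: "0 \<le> \<sigma>" using le\<sigma>[OF G0] .

  \<comment> \<open>Compactness of the closed disc gives constants \<open>D\<close> and
    \<open>L\<close> that do not depend on \<open>n\<close>, so that the radius can be moved from
    \<open>s\<close> to \<open>\<sigma>\<close> before \<open>n\<close> is chosen.\<close>
  have "continuous_on (cball 0 \<sigma>) w" using w_cont by (simp add: continuous_at_imp_continuous_on)
  then obtain \<mu>0 where \<mu>0: "\<forall>\<mu>\<in>cball 0 \<sigma>. w \<mu> \<le> w \<mu>0"
    using continuous_attains_sup[of "cball (0::complex) \<sigma>" w] \<sigma> by auto
  define D where "D = w \<mu>0"
  have D: "w \<mu> \<le> D" if "cmod \<mu> \<le> \<sigma>" for \<mu> using \<mu>0 that by (simp add: D_def)
  have D0: "0 \<le> D" by (simp add: D_def w)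
  define L where "L = C * q a * D * D"
  have L: "0 \<le> L" using C D0 q_nonneg[OF a] by (simp add: L_def)
  have lip: "q (W \<mu> - W \<nu>) \<le> L * cmod (\<mu> - \<nu>)" if "cmod \<mu> \<le> \<sigma>" "cmod \<nu> \<le> \<sigma>" for \<mu> \<nu>
  proof -
    have "w \<mu> * w \<nu> \<le> D * D" using that by (intro mult_mono D D0 w)
    then have "C * q a * cmod (\<mu> - \<nu>) * (w \<mu> * w \<nu>) \<le> C * q a * cmod (\<mu> - \<nu>) * (D * D)"
      using C q_nonneg[OF a] by (intro mult_left_mono) auto
    then show ?thesis using resolvent[of \<mu> \<nu>] by (simp add: L_def mult_ac)
  qed

  define \<omega> where "\<omega> n k = cis (2 * pi * real k / real n)" for n k :: nat
  have \<omega>: "cmod (\<omega> n k) = 1" for n k by (simp add: \<omega>_def)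
  define F where "F n s = \<iota> (1 / of_nat n) * (\<Sum>k<n. W (of_real s * \<omega> n k))" for n and s :: real
  have F: "F n s \<in> R" for n s unfolding F_def by (intro closed)
  have F_le: "q (F n s) \<le> C * D" if "0 \<le> s" "s \<le> \<sigma>" "n > 0" for n s
  proof -
    have "q (F n s) \<le> C * cmod (1 / of_nat n) * q (\<Sum>k<n. W (of_real s * \<omega> n k))"
      unfolding F_def by (intro q_scale closed)
    moreover have "q (\<Sum>k<n. W (of_real s * \<omega> n k)) \<le> (\<Sum>k<n. D)"
      by (rule order_trans[OF q_sum sum_mono]) (use that \<omega> in \<open>auto simp: norm_mult simp flip: w_def intro!: D closed\<close>)
    then have "C * cmod (1 / of_nat n) * q (\<Sum>k<n. W (of_real s * \<omega> n k)) \<le> C * cmod (1 / of_nat n) * (\<Sum>k<n. D)"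
      using C by (intro mult_left_mono) auto
    ultimately show ?thesis using that by (simp add: norm_divide)
  qed
  have F_lip: "q (F n s - F n t) \<le> C * L * \<bar>s - t\<bar>" if "0 \<le> s" "s \<le> \<sigma>" "0 \<le> t" "t \<le> \<sigma>" "n > 0" for n s t
  proof -
    have "F n s - F n t = \<iota> (1 / of_nat n) * (\<Sum>k<n. W (of_real s * \<omega> n k) - W (of_real t * \<omega> n k))"
      by (simp add: F_def right_diff_distrib sum_subtractf)
    also have "q \<dots> \<le> C * cmod (1 / of_nat n) * q (\<Sum>k<n. W (of_real s * \<omega> n k) - W (of_real t * \<omega> n k))"
      by (intro q_scale closed)
    finally have "q (F n s - F n t) \<le> C * cmod (1 / of_nat n) * q (\<Sum>k<n. W (of_real s * \<omega> n k) - W (of_real t * \<omega> n k))" .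
    moreover have "q (\<Sum>k<n. W (of_real s * \<omega> n k) - W (of_real t * \<omega> n k)) \<le> (\<Sum>k<n. L * \<bar>s - t\<bar>)"
    proof (rule order_trans[OF q_sum sum_mono])
      fix k
      have "of_real s * \<omega> n k - of_real t * \<omega> n k = of_real (s - t) * \<omega> n k"
        by (simp add: algebra_simps)
      then have "cmod (of_real s * \<omega> n k - of_real t * \<omega> n k) = \<bar>s - t\<bar>"
        by (simp only: norm_mult \<omega> norm_of_real mult_1_right)
      then show "q (W (of_real s * \<omega> n k) - W (of_real t * \<omega> n k)) \<le> L * \<bar>s - t\<bar>"
        using lip[of "of_real s * \<omega> n k" "of_real t * \<omega> n k"] that by (simp add: norm_mult \<omega>)
    qed (intro closed)
    then have "C * cmod (1 / of_nat n) * q (\<Sum>k<n. W (of_real s * \<omega> n k) - W (of_real t * \<omega> n k))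
        \<le> C * cmod (1 / of_nat n) * (\<Sum>k<n. L * \<bar>s - t\<bar>)"
      using C by (intro mult_left_mono) auto
    ultimately show ?thesis using that by (simp add: norm_divide)
  qed
  have F_inv: "q (F n s * (1 - \<iota> (of_real (s ^ n)) * a ^ n) - 1) = 0" if n: "n > 0" for n s
  proof -
    let ?x = "\<lambda>k. \<iota> (of_real s * \<omega> n k) * a"
    \<comment> \<open>Since \<open>\<omega> n k ^ n = 1\<close>, the element
      \<open>1 - \<iota> (of_real (s ^ n)) * a ^ n\<close> is \<open>1 - ?x k ^ n\<close> for every
      \<open>k\<close>, hence divisible by \<open>1 - ?x k\<close>. The inverse \<open>W\<close>
      cancels this factor up to seminorm 0 and leaves a geometric sum; the average of these sums
      over \<open>k\<close> is 1.\<close>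
    have term_eq: "W (of_real s * \<omega> n k) * (1 - \<iota> (of_real (s ^ n)) * a ^ n) - (\<Sum>j<n. ?x k ^ j)
        = (W (of_real s * \<omega> n k) * (1 - ?x k) - 1) * (\<Sum>j<n. ?x k ^ j)" for k
    proof -
      have "\<omega> n k ^ n = cis (2 * pi * real k)"
        using n by (simp add: \<omega>_def Complex.DeMoivre)
      then have "\<omega> n k ^ n = 1" by (simp add: cis_multiple_2pi)
      then have "1 - \<iota> (of_real (s ^ n)) * a ^ n = 1 - ?x k ^ n"
        by (simp add: power_mult_distrib flip: \<iota>_power)
      also have "\<dots> = (1 - ?x k) * (\<Sum>j<n. ?x k ^ j)" by (rule one_diff_power_eq)
      finally show ?thesis by (simp only: left_diff_distrib mult.assoc mult_1_left)
    qed
    have "(\<Sum>k<n. \<Sum>j<n. ?x k ^ j) = (\<Sum>j<n. \<Sum>k<n. ?x k ^ j)" by (rule sum.swap)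
    also have "\<dots> = (\<Sum>j<n. \<iota> (of_real s ^ j * (\<Sum>k<n. \<omega> n k ^ j)) * a ^ j)"
      by (simp add: \<iota>_sum \<iota>_power \<iota>_mult power_mult_distrib sum_distrib_left sum_distrib_right)
    also have "\<dots> = (\<Sum>j<n. if j = 0 then \<iota> (of_nat n) else 0)"
      by (intro sum.cong refl) (simp add: \<omega>_def sum_root_of_unity_powers \<iota>_0)
    also have "\<dots> = \<iota> (of_nat n)" using n by (simp add: sum.delta)
    finally have dbl: "(\<Sum>k<n. \<Sum>j<n. ?x k ^ j) = \<iota> (of_nat n)" .
    have "F n s * (1 - \<iota> (of_real (s ^ n)) * a ^ n) - 1 =
      \<iota> (1 / of_nat n) * (\<Sum>k<n. W (of_real s * \<omega> n k) * (1 - \<iota> (of_real (s ^ n)) * a ^ n) - (\<Sum>j<n. ?x k ^ j))"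
      using n by (simp only: sum_subtractf dbl right_diff_distrib F_def flip: \<iota>_mult sum_distrib_right)
        (simp add: \<iota>_1 algebra_simps)
    also have "\<dots> = (\<Sum>k<n. (W (of_real s * \<omega> n k) * (1 - ?x k) - 1) * (\<Sum>j<n. ?x k ^ j)) * \<iota> (1 / of_nat n)"
      unfolding term_eq by (rule mult.commute)
    also have "q \<dots> = 0"
      by (intro q_zero_mult q_zero_sum closed W)
    finally show ?thesis .
  qed

  have "\<exists>n>0. q (a ^ n) * \<sigma> ^ n < 1"
  proof (cases "\<sigma> = 0")
    case False
    with \<sigma> have \<sigma>: "0 < \<sigma>" by simp
    \<comment> \<open>Chosen for the end of the estimate:
      \<open>q v \<le> 4 * \<epsilon> * q 1\<close> has to give \<open>C * q v \<le> 1 / 2\<close>,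
      and \<open>\<epsilon> \<le> 1 / 4\<close> lets the term \<open>q v * (2 * \<epsilon>)\<close>
      be absorbed on the left.\<close>
    define \<epsilon> where "\<epsilon> = 1 / (8 * C * q 1)"
    have \<epsilon>: "0 < \<epsilon>" using C q1 by (simp add: \<epsilon>_def)
    have "1 \<le> C * q 1" using mult_mono[OF C q1] C by simp
    then have \<epsilon>4: "\<epsilon> \<le> 1 / 4" by (simp add: \<epsilon>_def field_simps)
    \<comment> \<open>The summand 1 keeps the denominator positive when \<open>L\<close> is
      0.\<close>
    define \<delta> where "\<delta> = \<epsilon> / (C * L + 1)"
    have \<delta>: "0 < \<delta>" using \<epsilon> C L by (simp add: \<delta>_def add_nonneg_pos)
    obtain s where s: "s \<in> G" "\<sigma> - \<delta> < s"
      using \<delta> less_cSup_iff[OF _ bdd, of "\<sigma> - \<delta>"] G0 unfolding \<sigma>_def[symmetric] by auto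
    have s0: "0 \<le> s" "s \<le> \<sigma>" using s(1) le\<sigma> by (auto simp: G_def)
    obtain m where m: "m > 0" "q (a ^ m) * s ^ m < 1" using s(1) by (auto simp: G_def)
    define t where "t = q (a ^ m) * s ^ m"
    have t: "0 \<le> t" "t < 1" using m s0 by (auto simp: t_def intro!: mult_nonneg_nonneg q_nonneg closed)
    have "(\<lambda>k. C * D * C * t ^ k) \<longlonglongrightarrow> C * D * C * 0"
      using t by (intro tendsto_intros LIMSEQ_power_zero) simp
    then have "\<forall>\<^sub>F k in sequentially. C * D * C * t ^ k < \<epsilon>" by (rule order_tendstoD) (simp add: \<epsilon>)
    with eventually_gt_at_top[of "0::nat"] have "\<forall>\<^sub>F k in sequentially. 0 < k \<and> C * D * C * t ^ k < \<epsilon>"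
      by (rule eventually_conj)
    then obtain k where k: "0 < k" "C * D * C * t ^ k < \<epsilon>"
      using eventually_happens'[OF sequentially_bot] by auto
    \<comment> \<open>For multiples of \<open>m\<close> one has
      \<open>q (a ^ n) * s ^ n \<le> t ^ k\<close> with \<open>t < 1\<close>, so the exponent can
      make this as small as desired.\<close>
    define n where "n = m * k"
    have n: "n > 0" using m k by (simp add: n_def)
    define u where "u = \<iota> (of_real (s ^ n)) * a ^ n"
    define v where "v = \<iota> (of_real (\<sigma> ^ n)) * a ^ n"
    have uR: "u \<in> R" "v \<in> R" unfolding u_def v_def by (intro closed)+
    have "q u \<le> C * s ^ n * q (a ^ n)"
      using q_scale[of "a ^ n" "of_real (s ^ n)"] s0 by (simp add: u_def closed norm_power)
    also have "\<dots> \<le> C * s ^ n * q (a ^ m) ^ k"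
      unfolding n_def power_mult[of a] using k s0 C by (intro mult_left_mono q_power closed) auto
    also have "\<dots> = C * t ^ k" by (simp add: t_def n_def power_mult power_mult_distrib)
    finally have u: "q u \<le> C * t ^ k" .
    have "F n s - 1 = (F n s * (1 - u) - 1) + F n s * u" by (simp add: algebra_simps)
    also have "q \<dots> \<le> q (F n s * (1 - u) - 1) + q (F n s * u)" by (intro q_add closed F uR)
    also have "\<dots> \<le> 0 + q (F n s) * q u" using F_inv[OF n, of s] q_mult[OF F uR(1)] unfolding u_def[symmetric] by simp
    also have "\<dots> \<le> 0 + C * D * (C * t ^ k)"
      by (intro add_mono mult_mono order_refl u F_le s0 n q_nonneg uR) (use C D0 in simp)
    also have "\<dots> < \<epsilon>" using k by (simp add: mult_ac)
    finally have 1: "q (F n s - 1) < \<epsilon>" .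
    have "q (F n \<sigma> - F n s) \<le> C * L * \<bar>\<sigma> - s\<bar>" using s0 n \<sigma> by (intro F_lip) auto
    also have "\<dots> \<le> C * L * \<delta>" using s s0 C L by (intro mult_left_mono) auto
    also have "\<dots> \<le> (C * L + 1) * \<delta>" using \<delta> by (intro mult_right_mono) auto
    also have "\<dots> = \<epsilon>"
    proof -
      have "0 \<le> C * L" using C L by simp
      then have "C * L + 1 \<noteq> 0" by linarith
      then show ?thesis by (simp add: \<delta>_def)
    qed
    finally have 2: "q (F n \<sigma> - F n s) \<le> \<epsilon>" .
    have "q (F n \<sigma> - 1) \<le> 2 * \<epsilon>"
      using q_add[of "F n \<sigma> - F n s" "F n s - 1"] 1 2 by (simp add: closed F)
    then have 3: "q (1 - F n \<sigma>) \<le> 2 * \<epsilon>"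
      using q_uminus[of "1 - F n \<sigma>"] by (simp add: closed F)
    \<comment> \<open>The argument on the right is \<open>- v\<close>, written so that the closeness
      of \<open>F n \<sigma>\<close> to 1 controls it; the factor \<open>1 - v\<close> brings back
      \<open>q v\<close> with a small coefficient.\<close>
    have "q v = q ((1 - v) * (1 - F n \<sigma>) + (F n \<sigma> * (1 - v) - 1))"
      using q_uminus[OF uR(2)] by (simp add: algebra_simps)
    also have "\<dots> \<le> q ((1 - v) * (1 - F n \<sigma>)) + q (F n \<sigma> * (1 - v) - 1)" by (intro q_add closed F uR)
    also have "\<dots> \<le> q (1 - v) * q (1 - F n \<sigma>) + 0"
      using F_inv[OF n, of \<sigma>] q_mult[of "1 - v" "1 - F n \<sigma>"] unfolding v_def[symmetric]
      by (simp add: F uR closed)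
    also have "\<dots> \<le> (q 1 + q v) * (2 * \<epsilon>) + 0"
      using q1 by (intro add_mono mult_mono order_refl 3 q_diff q_nonneg closed F uR add_nonneg_nonneg)
    finally have "q v \<le> 2 * \<epsilon> * q 1 + q v * (2 * \<epsilon>)" by (simp add: algebra_simps)
    moreover have "q v * (2 * \<epsilon>) \<le> q v * (1 / 2)" using \<epsilon>4 by (intro mult_left_mono q_nonneg uR) simp
    ultimately have "q v \<le> 4 * \<epsilon> * q 1" by simp
    then have "C * q v \<le> C * (4 * \<epsilon> * q 1)" using C by (intro mult_left_mono) auto
    also have "\<dots> = 1 / 2" using C q1 by (simp add: \<epsilon>_def)
    finally have qv: "C * q v \<le> 1 / 2" .
    have "a ^ n = \<iota> (of_real (inverse (\<sigma> ^ n))) * v"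
      unfolding v_def mult.assoc[symmetric] using \<sigma>
      by (simp only: flip: \<iota>_mult of_real_mult) (simp add: \<iota>_1)
    then have "q (a ^ n) \<le> C * inverse (\<sigma> ^ n) * q v"
      using q_scale[OF uR(2), of "of_real (inverse (\<sigma> ^ n))"] \<sigma> by (simp add: norm_power norm_inverse)
    then have "q (a ^ n) * \<sigma> ^ n \<le> C * q v" using \<sigma> by (simp add: field_simps)
    then show ?thesis using qv n by (intro exI[of _ n]) auto
  qed (auto intro: exI[of _ 1])
  then obtain n where n: "n > 0" "q (a ^ n) * \<sigma> ^ n < 1" by blast
  have "((\<lambda>s. q (a ^ n) * s ^ n) \<longlongrightarrow> q (a ^ n) * \<sigma> ^ n) (at_right \<sigma>)" by (intro tendsto_intros)
  then have "\<forall>\<^sub>F s in at_right \<sigma>. q (a ^ n) * s ^ n < 1" using n(2) by (rule order_tendstoD)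
  with eventually_at_right_less[of \<sigma>] have "\<forall>\<^sub>F s in at_right \<sigma>. \<sigma> < s \<and> q (a ^ n) * s ^ n < 1"
    by (rule eventually_conj)
  then obtain s where "\<sigma> < s" "q (a ^ n) * s ^ n < 1"
    using eventually_happens'[OF trivial_limit_at_right_real] by auto
  then have "s \<in> G" using \<sigma> n(1) by (auto simp: G_def)
  then show False using le\<sigma>[of s] \<open>\<sigma> < s\<close> by simp
qed

end

subsection \<open>Ideals and characters of Banach algebras\<close>

context seminormed_complex_ring
begin

definition ring_ideal :: "'a set \<Rightarrow> bool" where
  "ring_ideal I \<longleftrightarrow> I \<subseteq> R \<and> 0 \<in> I \<and> (\<forall>x\<in>I. \<forall>y\<in>I. x + y \<in> I) \<and> (\<forall>x\<in>R. \<forall>y\<in>I. x * y \<in> I)"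

lemma ring_idealI:
  assumes "I \<subseteq> R" "0 \<in> I" "\<And>x y. x \<in> I \<Longrightarrow> y \<in> I \<Longrightarrow> x + y \<in> I" "\<And>x y. x \<in> R \<Longrightarrow> y \<in> I \<Longrightarrow> x * y \<in> I"
  shows "ring_ideal I"
  using assms by (auto simp: ring_ideal_def)

lemma ring_idealD:
  assumes "ring_ideal I"
  shows "I \<subseteq> R" "0 \<in> I" "\<And>x y. x \<in> I \<Longrightarrow> y \<in> I \<Longrightarrow> x + y \<in> I" "\<And>x y. x \<in> R \<Longrightarrow> y \<in> I \<Longrightarrow> x * y \<in> I"
    "\<And>x. x \<in> I \<Longrightarrow> - x \<in> I"
proof -
  show *: "I \<subseteq> R" "0 \<in> I" "\<And>x y. x \<in> I \<Longrightarrow> y \<in> I \<Longrightarrow> x + y \<in> I" "\<And>x y. x \<in> R \<Longrightarrow> y \<in> I \<Longrightarrow> x * y \<in> I"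
    using assms by (auto simp: ring_ideal_def)
  show "- x \<in> I" if "x \<in> I" for x
    using *(4)[OF \<iota>_closed[of "- 1"] that] by (simp add: \<iota>_minus \<iota>_1)
qed

lemma ring_ideal_Union_chain:
  assumes "\<C> \<noteq> {}" and chain: "\<And>I J. I \<in> \<C> \<Longrightarrow> J \<in> \<C> \<Longrightarrow> I \<subseteq> J \<or> J \<subseteq> I"
    and ideal: "\<And>I. I \<in> \<C> \<Longrightarrow> ring_ideal I"
  shows "ring_ideal (\<Union>\<C>)"
proof (rule ring_idealI)
  fix x y assume "x \<in> \<Union>\<C>" "y \<in> \<Union>\<C>"
  then obtain I J where "I \<in> \<C>" "x \<in> I" "J \<in> \<C>" "y \<in> J" by blast
  then obtain L where "L \<in> \<C>" "x \<in> L" "y \<in> L" using chain by blast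
  then show "x + y \<in> \<Union>\<C>" using ring_idealD(3)[OF ideal] by blast
next
  show "\<Union>\<C> \<subseteq> R" using ring_idealD(1)[OF ideal] by blast
  show "0 \<in> \<Union>\<C>" using ring_idealD(2)[OF ideal] \<open>\<C> \<noteq> {}\<close> by blast
  show "x * y \<in> \<Union>\<C>" if "x \<in> R" "y \<in> \<Union>\<C>" for x y
    using ring_idealD(4)[OF ideal] that by blast
qed

lemma maximal_ring_ideal:
  assumes I: "ring_ideal I" "1 \<notin> I"
  obtains M where "I \<subseteq> M" "ring_ideal M" "1 \<notin> M"
    "\<And>J. M \<subseteq> J \<Longrightarrow> ring_ideal J \<Longrightarrow> 1 \<notin> J \<Longrightarrow> J = M"
proof -
  define \<A> where "\<A> = {J. I \<subseteq> J \<and> ring_ideal J \<and> 1 \<notin> J}"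
  have "\<exists>M\<in>\<A>. \<forall>J\<in>\<A>. M \<subseteq> J \<longrightarrow> J = M"
  proof (rule subset_Zorn_nonempty)
    show "\<A> \<noteq> {}" using I by (auto simp: \<A>_def)
    fix \<C> assume \<C>: "\<C> \<noteq> {}" "subset.chain \<A> \<C>"
    then have "ring_ideal (\<Union>\<C>)"
      by (intro ring_ideal_Union_chain) (auto simp: subset_chain_def \<A>_def)
    with \<C> show "\<Union>\<C> \<in> \<A>" by (auto simp: subset_chain_def \<A>_def)
  qed
  then obtain M where "M \<in> \<A>" "\<And>J. J \<in> \<A> \<Longrightarrow> M \<subseteq> J \<Longrightarrow> J = M" by blast
  then show ?thesis by (intro that[of M]) (auto simp: \<A>_def)
qed

end

locale complex_banach_ring = seminormed_complex_ring +
  assumes q_eq_0: "x \<in> R \<Longrightarrow> q x = 0 \<Longrightarrow> x = 0"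
    and complete: "(\<And>n. u n \<in> R) \<Longrightarrow> (\<And>e. e > 0 \<Longrightarrow> \<exists>M. \<forall>m\<ge>M. \<forall>n\<ge>M. q (u m - u n) < e) \<Longrightarrow>
      \<exists>f\<in>R. (\<lambda>n::nat. q (u n - f)) \<longlonglongrightarrow> 0"
begin

text \<open>Needed for maximal ideals: an element of an ideal at distance less than 1 from the unit
  would be invertible, so a proper ideal keeps distance at least 1 from it and the distance seminorm
  of 1 does not vanish.\<close>

lemma neumann:
  assumes x: "x \<in> R" and lt: "q (1 - x) < 1"
  shows "\<exists>y\<in>R. y * x = 1"
proof -
  define z where "z = 1 - x"
  have z: "z \<in> R" "q z < 1" using x lt by (auto simp: z_def closed)
  have r: "0 \<le> q z" by (rule q_nonneg[OF z(1)])
  have sum: "summable (\<lambda>k. q (z ^ k))"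
  proof (rule summable_comparison_test_ev)
    show "\<forall>\<^sub>F k in sequentially. norm (q (z ^ k)) \<le> q z ^ k"
      using eventually_gt_at_top[of "0::nat"]
      by eventually_elim (simp add: q_power z q_nonneg closed)
  qed (simp add: z r summable_geometric)
  define u where "u n = (\<Sum>k<n. z ^ k)" for n
  have u: "u n \<in> R" for n unfolding u_def by (intro closed z)
  have diff: "q (u n - u m) \<le> (\<Sum>k=m..<n. q (z ^ k))" if "m \<le> n" for m n
  proof -
    have "u n - u m = (\<Sum>k=m..<n. z ^ k)"
      using that by (simp add: u_def lessThan_atLeast0 sum_diff_nat_ivl)
    then show ?thesis by (simp only:) (intro q_sum closed z)
  qed
  have "\<exists>y\<in>R. (\<lambda>n. q (u n - y)) \<longlonglongrightarrow> 0"
  proof (rule complete)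
    fix e :: real assume "e > 0"
    then obtain M where M: "\<And>m n. m \<ge> M \<Longrightarrow> norm (\<Sum>k=m..<n. q (z ^ k)) < e"
      using sum unfolding summable_Cauchy by blast
    have *: "q (u n - u m) < e" if "M \<le> m" "m \<le> n" for m n
      using diff[OF that(2)] M[OF that(1), of n] by simp
    have "q (u m - u n) < e" if "M \<le> m" "M \<le> n" for m n
    proof (cases "m \<le> n")
      case True
      then show ?thesis using *[of m n] q_uminus[of "u n - u m"] that by (simp add: closed u)
    qed (use *[of n m] that in simp)
    then show "\<exists>M. \<forall>m\<ge>M. \<forall>n\<ge>M. q (u m - u n) < e" by blast
  qed (rule u)
  then obtain y where y: "y \<in> R" "(\<lambda>n. q (u n - y)) \<longlonglongrightarrow> 0" by blast
  have le: "q (y * x - 1) \<le> q (u n - y) * q x + q (z ^ n)" for n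
  proof -
    have "1 - z ^ n = x * u n" unfolding u_def one_diff_power_eq by (simp add: z_def)
    then have "y * x - 1 = - ((u n - y) * x) - z ^ n" by (simp add: algebra_simps)
    also have "q \<dots> \<le> q (- ((u n - y) * x)) + q (z ^ n)" by (intro q_diff closed u y x z)
    also have "q (- ((u n - y) * x)) = q ((u n - y) * x)" by (intro q_uminus closed u y x)
    also have "\<dots> \<le> q (u n - y) * q x" by (intro q_mult closed u y x)
    finally show ?thesis by simp
  qed
  have "(\<lambda>n. q (u n - y) * q x + q (z ^ n)) \<longlonglongrightarrow> 0 * q x + 0"
    by (intro tendsto_intros y summable_LIMSEQ_zero sum)
  then have "q (y * x - 1) \<le> 0 * q x + 0"
    by (rule tendsto_lowerbound) (use le in auto)
  then have "q (y * x - 1) = 0" using q_nonneg[of "y * x - 1"] by (simp add: closed y x)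
  then have "y * x - 1 = 0" by (intro q_eq_0 closed y x)
  then show ?thesis using y by auto
qed

text \<open>The quotient by a maximal ideal \<open>M\<close> is represented by the distance from \<open>M\<close>, a seminorm
  with kernel \<open>M\<close>.\<close>

theorem ring_ideal_in_character_kernel:
  assumes I: "ring_ideal I" "1 \<notin> I"
  obtains \<psi> :: "'a \<Rightarrow> complex" where
    "\<And>x y. x \<in> R \<Longrightarrow> y \<in> R \<Longrightarrow> \<psi> (x + y) = \<psi> x + \<psi> y"
    "\<And>x y. x \<in> R \<Longrightarrow> y \<in> R \<Longrightarrow> \<psi> (x * y) = \<psi> x * \<psi> y"
    "\<And>c. \<psi> (\<iota> c) = c" "\<And>x. x \<in> I \<Longrightarrow> \<psi> x = 0"
proof -
  obtain M where IM: "I \<subseteq> M" and M: "ring_ideal M" "1 \<notin> M"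
    and max: "\<And>J. M \<subseteq> J \<Longrightarrow> ring_ideal J \<Longrightarrow> 1 \<notin> J \<Longrightarrow> J = M"
    using maximal_ring_ideal[OF I] by blast
  note MD = ring_idealD[OF M(1)]
  have MR: "x \<in> R" if "x \<in> M" for x using MD(1) that by blast
  define d where "d x = (INF m\<in>M. q (x - m))" for x
  have bdd: "bdd_below ((\<lambda>m. q (x - m)) ` M)" if "x \<in> R" for x
    using that by (intro bdd_belowI2[where m = 0] q_nonneg diff_closed) (auto intro: MR)
  have d_le: "d x \<le> q (x - m)" if "x \<in> R" "m \<in> M" for x m
    unfolding d_def by (intro cINF_lower bdd that)
  have d_ge: "b \<le> d x" if "\<And>m. m \<in> M \<Longrightarrow> b \<le> q (x - m)" for b x
    unfolding d_def using MD(2) that by (intro cINF_greatest) auto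
  have d_approx: "\<exists>m\<in>M. q (x - m) < d x + e" if "x \<in> R" "0 < e" for x e
    using d_ge[of "d x + e" x] that by force
  have d_q: "d x \<le> q x" if "x \<in> R" for x using d_le[OF that MD(2)] by simp
  have d_nonneg: "0 \<le> d x" if "x \<in> R" for x
    using that by (intro d_ge q_nonneg diff_closed) (auto intro: MR)
  have d_M: "d m = 0" if "m \<in> M" for m
    using d_le[OF MR that, of m] d_nonneg[OF MR, of m] that by (simp add: q_0)
  interpret Q: seminormed_complex_ring R \<iota> d C
  proof
    fix x y assume xy: "x \<in> R" "y \<in> R"
    show "d (x + y) \<le> d x + d y"
    proof (rule field_le_epsilon)
      fix e :: real assume "0 < e"
      then obtain m n where mn: "m \<in> M" "n \<in> M" "q (x - m) < d x + e / 2" "q (y - n) < d y + e / 2"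
        using d_approx[OF xy(1), of "e / 2"] d_approx[OF xy(2), of "e / 2"] by auto
      have "d (x + y) \<le> q (x + y - (m + n))" by (intro d_le closed xy MD mn)
      also have "x + y - (m + n) = (x - m) + (y - n)" by simp
      also have "q \<dots> \<le> q (x - m) + q (y - n)" by (intro q_add closed xy MR[OF mn(1)] MR[OF mn(2)])
      finally show "d (x + y) \<le> d x + d y + e" using mn by simp
    qed
    show "d (x * y) \<le> d x * d y"
    proof -
      have 1: "d (x * y) \<le> q (x - m) * q (y - n)" if "m \<in> M" "n \<in> M" for m n
      proof -
        \<comment> \<open>The product \<open>(x - m) * (y - n)\<close> differs from
          \<open>x * y\<close> by this element of \<open>M\<close>, so it competes in the infimum
          defining \<open>d (x * y)\<close>.\<close>
        have "x * n + m * y - m * n \<in> M"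
          using MD(3)[OF MD(3)[OF MD(4)[of x n] MD(4)[of y m]] MD(4)[of "- m" n]] that
          by (simp add: xy MR closed mult.commute)
        then have "d (x * y) \<le> q (x * y - (x * n + m * y - m * n))" by (intro d_le closed xy)
        also have "x * y - (x * n + m * y - m * n) = (x - m) * (y - n)" by (simp add: algebra_simps)
        also have "q \<dots> \<le> q (x - m) * q (y - n)" by (intro q_mult closed xy MR[OF that(1)] MR[OF that(2)])
        finally show ?thesis .
      qed
      have lim: "((\<lambda>e. (d x + e) * (d y + e)) \<longlongrightarrow> (d x + 0) * (d y + 0)) (at_right 0)"
        by (intro tendsto_intros)
      have "d (x * y) \<le> (d x + 0) * (d y + 0)"
      proof (rule tendsto_lowerbound[OF lim])
        show "\<forall>\<^sub>F e in at_right 0. d (x * y) \<le> (d x + e) * (d y + e)"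
          using eventually_at_right_less[of "0::real"]
        proof eventually_elim
          case (elim e)
          then obtain m n where mn: "m \<in> M" "n \<in> M" "q (x - m) < d x + e" "q (y - n) < d y + e"
            using d_approx xy by blast
          then have "q (x - m) * q (y - n) \<le> (d x + e) * (d y + e)"
            using elim d_nonneg[OF xy(1)] by (intro mult_mono q_nonneg closed xy) (auto intro: MR)
          then show ?case using 1[OF mn(1,2)] by linarith
        qed
      qed simp
      then show ?thesis by simp
    qed
    have *: "d (- x) \<le> d x" if "x \<in> R" for x
    proof (rule d_ge)
      fix m assume m: "m \<in> M"
      have "d (- x) \<le> q (- x - - m)" by (intro d_le closed MD m that)
      also have "- x - - m = - (x - m)" by simp
      also have "q \<dots> = q (x - m)" by (intro q_uminus closed that MR[OF m])
      finally show "d (- x) \<le> q (x - m)" .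
    qed
    show "d (- x) = d x" using *[OF xy(1)] *[of "- x"] xy by (simp add: closed)
  next
    show "d (\<iota> c) \<le> C * cmod c" for c using d_q[OF \<iota>_closed] q_\<iota> by (rule order_trans)
  qed (auto intro: closed d_nonneg \<iota>_add \<iota>_mult \<iota>_1)

  have d1: "1 \<le> d 1"
  proof (rule d_ge, rule ccontr)
    fix m assume m: "m \<in> M" "\<not> 1 \<le> q (1 - m)"
    then obtain y where "y \<in> R" "y * m = 1" using neumann[of m] MR by auto
    then show False using MD(4)[of y m] m M(2) by simp
  qed
  have kernel: "x \<in> M" if x: "x \<in> R" "d x = 0" for x
  proof -
    \<comment> \<open>The kernel of \<open>d\<close> is a proper ideal containing \<open>M\<close>,
      so maximality identifies the two; this is the closedness of maximal ideals.\<close>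
    have "{x \<in> R. d x = 0} = M"
    proof (rule max)
      show "M \<subseteq> {x \<in> R. d x = 0}" using d_M MR by blast
      show "ring_ideal {x \<in> R. d x = 0}"
      proof (rule ring_idealI)
        show "x * y \<in> {x \<in> R. d x = 0}" if "x \<in> R" "y \<in> {x \<in> R. d x = 0}" for x y
          using Q.q_zero_mult[of y x] that by (simp add: closed mult.commute)
      qed (auto intro: closed Q.q_zero_add Q.q_0)
      show "1 \<notin> {x \<in> R. d x = 0}" using d1 by simp
    qed
    then show ?thesis using x by blast
  qed
  have inv: "\<exists>y\<in>R. d (x * y - 1) = 0" if x: "x \<in> R" "d x \<noteq> 0" for x
  proof -
    define J where "J = {m + r * x | m r. m \<in> M \<and> r \<in> R}"
    have "ring_ideal J"
    proof (rule ring_idealI)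
      show "J \<subseteq> R" by (auto simp: J_def intro!: add_closed mult_closed x intro: MR)
      show "0 \<in> J" unfolding J_def using MD(2) zero_closed by force
    next
      fix a b assume "a \<in> J" "b \<in> J"
      then obtain m r m' r' where "a = m + r * x" "b = m' + r' * x" "m \<in> M" "m' \<in> M" "r \<in> R" "r' \<in> R"
        by (auto simp: J_def)
      then have "a + b = (m + m') + (r + r') * x" "m + m' \<in> M" "r + r' \<in> R"
        by (auto simp: algebra_simps intro: MD closed)
      then show "a + b \<in> J" unfolding J_def by blast
    next
      fix a b assume a: "a \<in> R" and "b \<in> J"
      then obtain m r where "b = m + r * x" "m \<in> M" "r \<in> R" by (auto simp: J_def)
      then have "a * b = a * m + (a * r) * x" "a * m \<in> M" "a * r \<in> R"
        using a by (auto simp: algebra_simps intro: MD closed)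
      then show "a * b \<in> J" unfolding J_def by blast
    qed
    moreover have "M \<subseteq> J" unfolding J_def using zero_closed by force
    moreover have "x = 0 + 1 * x" by simp
    then have "x \<in> J" unfolding J_def using MD(2) one_closed by blast
    then have "J \<noteq> M" using d_M x by auto
    ultimately have "1 \<in> J" using max by blast
    then obtain m r where m: "1 = m + r * x" "m \<in> M" "r \<in> R" by (auto simp: J_def)
    then have "x * r - 1 = - m" by (simp add: algebra_simps)
    then have "d (x * r - 1) = 0" using MD(5)[OF m(2)] d_M by simp
    then show ?thesis using m by blast
  qed
  have "\<exists>c. x - \<iota> c \<in> M" if x: "x \<in> R" for x
  proof -
    have "\<exists>c. d (x - \<iota> c) = 0" by (rule Q.gelfand_mazur[OF _ _ x]) (use d1 inv in auto)
    then show ?thesis using kernel[OF diff_closed[OF x \<iota>_closed]] by blast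
  qed
  then obtain \<psi> where \<psi>: "\<And>x. x \<in> R \<Longrightarrow> x - \<iota> (\<psi> x) \<in> M" by metis
  \<comment> \<open>The scalar is unique, since two different ones would put a nonzero constant,
    hence 1, into \<open>M\<close>. Each property of \<open>\<psi>\<close> thereby reduces to a
    membership in \<open>M\<close>.\<close>
  have \<psi>_eq: "\<psi> x = c" if "x \<in> R" "x - \<iota> c \<in> M" for x c
  proof (rule ccontr)
    assume ne: "\<psi> x \<noteq> c"
    have "(x - \<iota> c) + - (x - \<iota> (\<psi> x)) \<in> M" by (intro MD \<psi> that)
    then have "\<iota> (\<psi> x - c) \<in> M" by (simp add: \<iota>_diff)
    then have "\<iota> (1 / (\<psi> x - c)) * \<iota> (\<psi> x - c) \<in> M" by (intro MD \<iota>_closed)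
    then show False using ne M(2) by (simp add: \<iota>_1 flip: \<iota>_mult)
  qed
  show ?thesis
  proof (rule that)
    show "\<psi> (x + y) = \<psi> x + \<psi> y" if "x \<in> R" "y \<in> R" for x y
      using MD(3)[OF \<psi>[OF that(1)] \<psi>[OF that(2)]] that
      by (intro \<psi>_eq add_closed) (simp_all add: \<iota>_add add_diff_add)
    show "\<psi> (x * y) = \<psi> x * \<psi> y" if "x \<in> R" "y \<in> R" for x y
    proof (intro \<psi>_eq mult_closed that)
      have "y * (x - \<iota> (\<psi> x)) + \<iota> (\<psi> x) * (y - \<iota> (\<psi> y)) \<in> M"
        by (intro MD(3) MD(4) \<psi> that \<iota>_closed)
      then show "x * y - \<iota> (\<psi> x * \<psi> y) \<in> M" by (simp add: \<iota>_mult algebra_simps)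
    qed
    show "\<psi> (\<iota> c) = c" for c by (rule \<psi>_eq) (simp_all add: \<iota>_closed MD(2))
    show "\<psi> x = 0" if "x \<in> I" for x
      using that IM MR[of x] by (intro \<psi>_eq) (auto simp: \<iota>_0)
  qed
qed

end

subsection \<open>Regular function algebras\<close>

lemma apply_bcf_scale:
  assumes K: "K = \<real> \<or> K = UNIV" and sc: "banach_space_over K sc" and c: "c \<in> K"
  shows "apply_bcontfun (bcf_scale sc c h) x = sc c (h x)"
  unfolding bcf_scale_def using c
  by (subst apply_bcf_mult[OF K sc]) (auto simp: const_bcontfun.rep_eq)

locale regular_function_algebra =
  fixes K :: "complex set" and A :: "('x::t2_space \<Rightarrow>\<^sub>C complex) set"
  assumes K: "K = \<real> \<or> K = UNIV"
    and compact: "compact (UNIV :: 'x set)"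
    and algebra: "banach_function_algebra K A"
    and regular: "regular_algebra K A"
begin

lemma A_vals: "f \<in> A \<Longrightarrow> apply_bcontfun f x \<in> K"
  using algebra by (auto simp: banach_function_algebra_def)

lemma A_range: "f \<in> A \<Longrightarrow> range (apply_bcontfun f) \<subseteq> K"
  using algebra by (auto simp: banach_function_algebra_def)

lemma K_of_real: "of_real r \<in> K" using K by auto

lemma apply_mult: "f \<in> A \<Longrightarrow> apply_bcontfun (bcf_mult (*) f g) x = f x * g x"
  using apply_bcf_mult[OF K banach_space_over_complex A_range] .

lemma apply_scale: "c \<in> K \<Longrightarrow> apply_bcontfun (bcf_scale (*) c f) x = c * f x"
  using apply_bcf_scale[OF K banach_space_over_complex] .

lemma A_zero: "0 \<in> A" and A_add: "f \<in> A \<Longrightarrow> g \<in> A \<Longrightarrow> f + g \<in> A"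
  and A_scale: "c \<in> K \<Longrightarrow> f \<in> A \<Longrightarrow> bcf_scale (*) c f \<in> A"
  and A_mult: "f \<in> A \<Longrightarrow> g \<in> A \<Longrightarrow> bcf_mult (*) f g \<in> A"
  and A_const: "c \<in> K \<Longrightarrow> const_bcontfun c \<in> A"
  using algebra by (auto simp: banach_function_algebra_def subspace_over_def)

lemma scale_minus_one: "bcf_scale (*) (- 1) f = - f"
  using K_of_real[of "- 1"] by (intro bcontfun_eqI) (simp add: apply_scale)

lemma A_uminus: "f \<in> A \<Longrightarrow> - f \<in> A"
  using A_scale[of "- 1" f] K_of_real[of "- 1"] by (simp add: scale_minus_one)

lemma A_diff: "f \<in> A \<Longrightarrow> g \<in> A \<Longrightarrow> f - g \<in> A"
  using A_add[of f "- g"] A_uminus by simp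

text \<open>\<open>R\<close> may be larger than the image of \<open>A\<close>, which allows for the
  complexification of a real algebra. Homogeneity over \<open>K\<close> comes from multiplicativity,
  as scalars are constant functions in \<open>R\<close>.\<close>

lemma characterI:
  fixes \<psi> :: "('x \<Rightarrow> complex) \<Rightarrow> complex"
  assumes R: "apply_bcontfun ` A \<subseteq> R" "\<And>c. (\<lambda>_. c) \<in> R"
    and add: "\<And>x y. x \<in> R \<Longrightarrow> y \<in> R \<Longrightarrow> \<psi> (x + y) = \<psi> x + \<psi> y"
    and mult: "\<And>x y. x \<in> R \<Longrightarrow> y \<in> R \<Longrightarrow> \<psi> (x * y) = \<psi> x * \<psi> y"
    and const: "\<And>c. \<psi> (\<lambda>_. c) = c"
  shows "restrict (\<lambda>f. \<psi> (apply_bcontfun f)) A \<in> characters K A"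
proof -
  have fR: "apply_bcontfun f \<in> R" if "f \<in> A" for f using R that by blast
  have 1: "apply_bcontfun (f + g) = apply_bcontfun f + apply_bcontfun g" for f g :: "'x \<Rightarrow>\<^sub>C complex"
    by (simp add: fun_eq_iff plus_bcontfun.rep_eq)
  have 2: "apply_bcontfun (bcf_scale (*) c f) = (\<lambda>_. c) * apply_bcontfun f" if "c \<in> K" for c f
    using that by (simp add: fun_eq_iff apply_scale)
  have 3: "apply_bcontfun (bcf_mult (*) f g) = apply_bcontfun f * apply_bcontfun g" if "f \<in> A" for f g
    using that by (simp add: fun_eq_iff apply_mult)
  have "const_bcontfun 1 \<in> A" using A_const[OF K_of_real[of 1]] by simp
  moreover have "\<psi> (apply_bcontfun (const_bcontfun 1)) = 1"
    using const[of 1] by (simp add: const_bcontfun.rep_eq)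
  ultimately have "\<exists>f\<in>A. \<psi> (apply_bcontfun f) \<noteq> 0" by (metis one_neq_zero)
  moreover have "\<psi> (apply_bcontfun (f + g)) = \<psi> (apply_bcontfun f) + \<psi> (apply_bcontfun g)"
    if "f \<in> A" "g \<in> A" for f g
    unfolding 1 by (intro add fR that)
  moreover have "\<psi> (apply_bcontfun (bcf_scale (*) c f)) = c * \<psi> (apply_bcontfun f)"
    if "c \<in> K" "f \<in> A" for c f
    unfolding 2[OF that(1)] using mult[OF R(2) fR[OF that(2)]] by (simp add: const)
  moreover have "\<psi> (apply_bcontfun (bcf_mult (*) f g)) = \<psi> (apply_bcontfun f) * \<psi> (apply_bcontfun g)"
    if "f \<in> A" "g \<in> A" for f g
    unfolding 3[OF that(1)] by (intro mult fR that)
  ultimately show ?thesis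
    unfolding characters_def linear_over_def
    by (simp add: A_add A_scale A_mult del: plus_bcontfun.rep_eq)
qed

text \<open>A real algebra is complexified, so that in both cases the complex Gelfand-Mazur theorem
  applies.\<close>

lemma ideal_in_character_kernel:
  assumes I: "I \<subseteq> A" "0 \<in> I" "\<And>f g. f \<in> I \<Longrightarrow> g \<in> I \<Longrightarrow> f + g \<in> I"
      "\<And>f g. f \<in> A \<Longrightarrow> g \<in> I \<Longrightarrow> bcf_mult (*) f g \<in> I"
    and proper: "const_bcontfun 1 \<notin> I"
  shows "\<exists>\<psi>\<in>characters K A. \<forall>f\<in>I. \<psi> f = 0"
proof -
  obtain N :: "('x \<Rightarrow>\<^sub>C complex) \<Rightarrow> real" where
    norm: "\<forall>f\<in>A. 0 \<le> N f \<and> (N f = 0 \<longleftrightarrow> f = 0)"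
    "\<forall>f\<in>A. \<forall>g\<in>A. N (f + g) \<le> N f + N g"
    "\<forall>c\<in>K. \<forall>f\<in>A. N (bcf_scale (*) c f) = cmod c * N f"
    "\<forall>f\<in>A. \<forall>g\<in>A. N (bcf_mult (*) f g) \<le> N f * N g"
    "\<forall>u :: nat \<Rightarrow> ('x \<Rightarrow>\<^sub>C complex).
       (\<forall>n. u n \<in> A) \<and> (\<forall>e>0. \<exists>M. \<forall>m\<ge>M. \<forall>n\<ge>M. N (u m - u n) < e) \<longrightarrow>
       (\<exists>f\<in>A. (\<lambda>n. N (u n - f)) \<longlonglongrightarrow> 0)"
    using algebra unfolding banach_function_algebra_def by (elim conjE exE) (rule that; assumption)
  have N_nonneg: "0 \<le> N f" if "f \<in> A" for f using norm(1) that by blast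
  have N_eq_0: "f = 0" if "f \<in> A" "N f = 0" for f using norm(1) that by blast
  have N_add: "N (f + g) \<le> N f + N g" if "f \<in> A" "g \<in> A" for f g using norm(2) that by blast
  have N_mult: "N (bcf_mult (*) f g) \<le> N f * N g" if "f \<in> A" "g \<in> A" for f g
    using norm(4) that by blast
  have N_uminus: "N (- f) = N f" if "f \<in> A" for f
    using norm(3) that K_of_real[of "- 1"] by (simp flip: scale_minus_one)
  have N_diff: "N (f - g) \<le> N f + N g" if "f \<in> A" "g \<in> A" for f g
    using N_add[of f "- g"] N_uminus[of g] A_uminus that by simp
  have N_const: "N (const_bcontfun c) = cmod c * N (const_bcontfun 1)" if "c \<in> K" for c
  proof -
    have "const_bcontfun c = bcf_scale (*) c (const_bcontfun 1)"
      using that by (intro bcontfun_eqI) (simp add: apply_scale)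
    then show ?thesis using norm(3) that A_const[OF K_of_real[of 1]] by (metis of_real_1)
  qed
  have N_complete: "\<exists>f\<in>A. (\<lambda>n. N (u n - f)) \<longlonglongrightarrow> 0"
    if "\<And>n. u n \<in> A" "\<And>e. e > 0 \<Longrightarrow> \<exists>M. \<forall>m\<ge>M. \<forall>n\<ge>M. N (u m - u n) < e" for u :: "nat \<Rightarrow> _"
    using norm(5) that by blast
  define N1 where "N1 = N (const_bcontfun 1)"
  have N1: "0 \<le> N1" using A_const[OF K_of_real[of 1]] by (simp add: N1_def N_nonneg)
  have const_apply: "apply_bcontfun (const_bcontfun c) = (\<lambda>_. c)" for c :: complex
    by (simp add: fun_eq_iff const_bcontfun.rep_eq)
  \<comment> \<open>The part common to both scalar fields: it remains to embed \<open>A\<close> into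
    a complex Banach ring of functions in which \<open>I\<close> lies in a proper ideal
    \<open>J\<close>.\<close>
  have *: ?thesis if R: "complex_banach_ring R (\<lambda>c _. c) q C" and AR: "apply_bcontfun ` A \<subseteq> R"
    and J: "seminormed_complex_ring.ring_ideal R J" "1 \<notin> J" and IJ: "apply_bcontfun ` I \<subseteq> J" for R q C J
  proof -
    interpret complex_banach_ring R "\<lambda>c _. c" q C by (rule R)
    obtain \<psi> where \<psi>: "\<And>x y. x \<in> R \<Longrightarrow> y \<in> R \<Longrightarrow> \<psi> (x + y) = \<psi> x + \<psi> y"
      "\<And>x y. x \<in> R \<Longrightarrow> y \<in> R \<Longrightarrow> \<psi> (x * y) = \<psi> x * \<psi> y"
      "\<And>c. \<psi> (\<lambda>_. c) = c" "\<And>x. x \<in> J \<Longrightarrow> \<psi> x = 0"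
      using ring_ideal_in_character_kernel[OF J] by metis
    have "restrict (\<lambda>f. \<psi> (apply_bcontfun f)) A \<in> characters K A"
      by (rule characterI[OF AR \<iota>_closed \<psi>(1,2,3)])
    moreover have "restrict (\<lambda>f. \<psi> (apply_bcontfun f)) A f = 0" if "f \<in> I" for f
      using that I(1) IJ \<psi>(4) by auto
    ultimately show ?thesis by blast
  qed
  consider "K = UNIV" | "K = \<real>" using K by blast
  then show ?thesis
  proof cases
    case 1
    define R where "R = apply_bcontfun ` A"
    have R_cases: "\<exists>f\<in>A. x = apply_bcontfun f" if "x \<in> R" for x using that by (auto simp: R_def)
    have R_I: "x \<in> R" if "f \<in> A" "x = apply_bcontfun f" for x f using that by (auto simp: R_def)
    define q where "q x = N (Bcontfun x)" for x
    have q: "q (apply_bcontfun f) = N f" for f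
      by (simp add: q_def apply_bcontfun_inverse)
    have add: "apply_bcontfun f + apply_bcontfun g = apply_bcontfun (f + g)" for f g :: "'x \<Rightarrow>\<^sub>C complex"
      by (simp add: fun_eq_iff plus_bcontfun.rep_eq)
    have minus: "- apply_bcontfun f = apply_bcontfun (- f)" for f :: "'x \<Rightarrow>\<^sub>C complex"
      by (simp add: fun_eq_iff)
    have diff: "apply_bcontfun f - apply_bcontfun g = apply_bcontfun (f - g)" for f g :: "'x \<Rightarrow>\<^sub>C complex"
      by (simp add: fun_eq_iff)
    have mult: "apply_bcontfun f * apply_bcontfun g = apply_bcontfun (bcf_mult (*) f g)" if "f \<in> A" for f g
      using that by (simp add: fun_eq_iff apply_mult)
    have ring: "complex_banach_ring R (\<lambda>c _. c) q N1"
    proof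
      fix x y assume "x \<in> R" "y \<in> R"
      then obtain f g where fg: "f \<in> A" "x = apply_bcontfun f" "g \<in> A" "y = apply_bcontfun g"
        using R_cases by metis
      note eq = fg(2,4)
      show "x + y \<in> R" unfolding eq add by (intro R_I[OF _ refl] A_add fg)
      show "x * y \<in> R" unfolding eq mult[OF fg(1)] by (intro R_I[OF _ refl] A_mult fg)
      show "0 \<le> q x" unfolding eq q by (intro N_nonneg fg)
      show "q (x + y) \<le> q x + q y" unfolding eq add q by (intro N_add fg)
      show "q (- x) = q x" unfolding eq minus q by (intro N_uminus fg)
      show "q (x * y) \<le> q x * q y" unfolding eq mult[OF fg(1)] q by (intro N_mult fg)
      assume "q x = 0"
      then have "f = 0" unfolding eq q by (rule N_eq_0[OF fg(1)])
      then show "x = 0" unfolding eq by (simp add: fun_eq_iff)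
    next
      fix u :: "nat \<Rightarrow> 'x \<Rightarrow> complex"
      assume u: "\<And>n. u n \<in> R" and Cauchy: "\<And>e. e > 0 \<Longrightarrow> \<exists>M. \<forall>m\<ge>M. \<forall>n\<ge>M. q (u m - u n) < e"
      have "\<forall>n. \<exists>f. f \<in> A \<and> u n = apply_bcontfun f" using R_cases[OF u] by blast
      then obtain f where f: "\<And>n. f n \<in> A" "\<And>n. u n = apply_bcontfun (f n)" by metis
      have "\<exists>g\<in>A. (\<lambda>n. N (f n - g)) \<longlonglongrightarrow> 0"
        by (rule N_complete[OF f(1) Cauchy[unfolded f(2) diff q]])
      then obtain g where g: "g \<in> A" "(\<lambda>n. N (f n - g)) \<longlonglongrightarrow> 0" by blast
      show "\<exists>x\<in>R. (\<lambda>n. q (u n - x)) \<longlonglongrightarrow> 0"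
      proof
        show "(\<lambda>n. q (u n - apply_bcontfun g)) \<longlonglongrightarrow> 0" unfolding f(2) diff q by (rule g)
      qed (rule R_I[OF g(1) refl])
    next
      fix c :: complex
      have c: "c \<in> K" by (simp add: 1)
      show "(\<lambda>_. c) \<in> R" unfolding const_apply[symmetric] by (intro R_I[OF _ refl] A_const c)
      show "q (\<lambda>_. c) \<le> N1 * cmod c"
        unfolding const_apply[symmetric] q using N_const[OF c] by (simp add: N1_def)
    qed (simp_all add: fun_eq_iff)
    interpret complex_banach_ring R "\<lambda>c _. c" q N1 by (rule ring)
    show ?thesis
    proof (rule *[OF ring])
      show "ring_ideal (apply_bcontfun ` I)"
      proof (rule ring_idealI)
        show "apply_bcontfun ` I \<subseteq> R" using I(1) by (auto simp: R_def)
        have "0 = apply_bcontfun (0 :: 'x \<Rightarrow>\<^sub>C complex)" by (simp add: fun_eq_iff)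
        then show "0 \<in> apply_bcontfun ` I" using I(2) by blast
        show "x + y \<in> apply_bcontfun ` I" if "x \<in> apply_bcontfun ` I" "y \<in> apply_bcontfun ` I" for x y
        proof -
          from that obtain f g where fg: "f \<in> I" "x = apply_bcontfun f" "g \<in> I" "y = apply_bcontfun g"
            by blast
          then show ?thesis unfolding fg(2,4) add by (intro imageI I)
        qed
        show "x * y \<in> apply_bcontfun ` I" if "x \<in> R" "y \<in> apply_bcontfun ` I" for x y
        proof -
          from that R_cases obtain f g where
            fg: "f \<in> A" "x = apply_bcontfun f" "g \<in> I" "y = apply_bcontfun g" by blast
          then show ?thesis unfolding fg(2,4) mult[OF fg(1)] by (intro imageI I)
        qed
      qed
      show "1 \<notin> apply_bcontfun ` I"
      proof
        assume "1 \<in> apply_bcontfun ` I"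
        then obtain f where "f \<in> I" "1 = apply_bcontfun f" by blast
        then have "f = const_bcontfun 1" by (intro bcontfun_eqI) (simp add: const_apply flip: \<open>1 = _\<close>)
        then show False using proper \<open>f \<in> I\<close> by simp
      qed
    qed (auto simp: R_def)
  next
    case 2
    define c where "c f g = (\<lambda>x. apply_bcontfun f x + \<i> * apply_bcontfun g x)" for f g :: "'x \<Rightarrow>\<^sub>C complex"
    define R where "R = {c f g | f g. f \<in> A \<and> g \<in> A}"
    have R_cases: "\<exists>f\<in>A. \<exists>g\<in>A. x = c f g" if "x \<in> R" for x using that by (auto simp: R_def)
    have R_I: "x \<in> R" if "f \<in> A" "g \<in> A" "x = c f g" for x f g using that by (auto simp: R_def)
    \<comment> \<open>The sum norm of real and imaginary part. It is submultiplicative because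
      \<open>(N f + N g) * (N f' + N g')\<close> contains all four products. The constant
      \<open>2 * N1\<close> comes from bounding both \<open>Re z\<close> and \<open>Im z\<close> by
      \<open>cmod z\<close>.\<close>
    define q where "q x = N (Bcontfun (\<lambda>z. of_real (Re (x z)))) + N (Bcontfun (\<lambda>z. of_real (Im (x z))))" for x
    have real: "of_real (Re (apply_bcontfun f z)) = apply_bcontfun f z" "Im (apply_bcontfun f z) = 0"
      if "f \<in> A" for f z
      using A_vals[OF that, of z] by (auto simp: 2 elim!: Reals_cases)
    have c_Re: "of_real (Re (c f g z)) = apply_bcontfun f z"
      and c_Im: "of_real (Im (c f g z)) = apply_bcontfun g z" if "f \<in> A" "g \<in> A" for f g z
      using that by (simp_all add: c_def real)
    have q: "q (c f g) = N f + N g" if "f \<in> A" "g \<in> A" for f g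
      using that by (simp add: q_def c_Re c_Im apply_bcontfun_inverse)
    have c_eq: "f = f'" "g = g'" if "c f g = c f' g'" "f \<in> A" "g \<in> A" "f' \<in> A" "g' \<in> A" for f g f' g'
      using c_Re[OF that(2,3)] c_Re[OF that(4,5)] c_Im[OF that(2,3)] c_Im[OF that(4,5)] that(1)
      by (auto intro!: bcontfun_eqI)
    have add: "c f g + c f' g' = c (f + f') (g + g')" for f g f' g'
      by (simp add: c_def fun_eq_iff plus_bcontfun.rep_eq algebra_simps)
    have minus: "- c f g = c (- f) (- g)" for f g
      by (simp add: c_def fun_eq_iff)
    have diff: "c f g - c f' g' = c (f - f') (g - g')" for f g f' g'
      by (simp add: c_def fun_eq_iff algebra_simps)
    have mult: "c f g * c f' g' = c (bcf_mult (*) f f' - bcf_mult (*) g g') (bcf_mult (*) f g' + bcf_mult (*) g f')"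
      if "f \<in> A" "g \<in> A" for f g f' g'
      using that by (simp add: c_def fun_eq_iff apply_mult plus_bcontfun.rep_eq) (simp add: algebra_simps)
    have const: "(\<lambda>_. z) = c (const_bcontfun (of_real (Re z))) (const_bcontfun (of_real (Im z)))" for z
      by (simp add: c_def const_apply) (simp flip: complex_eq)
    have ring: "complex_banach_ring R (\<lambda>c _. c) q (2 * N1)"
    proof
      fix x y assume "x \<in> R" "y \<in> R"
      then obtain f g f' g' where fg: "f \<in> A" "g \<in> A" "x = c f g" "f' \<in> A" "g' \<in> A" "y = c f' g'"
        using R_cases by metis
      note eq = fg(3,6)
      show "x + y \<in> R" unfolding eq add by (intro R_I[OF _ _ refl] A_add fg)
      show "x * y \<in> R" unfolding eq mult[OF fg(1,2)] by (intro R_I[OF _ _ refl] A_mult A_add A_diff fg)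
      show "0 \<le> q x" unfolding eq using fg by (simp add: q N_nonneg)
      show "q (x + y) \<le> q x + q y"
        unfolding eq add using fg N_add[of f f'] N_add[of g g'] by (simp add: q A_add)
      show "q (- x) = q x" unfolding eq minus using fg by (simp add: q N_uminus A_uminus)
      have "N (bcf_mult (*) f f' - bcf_mult (*) g g') \<le> N f * N f' + N g * N g'"
        using fg N_diff[of "bcf_mult (*) f f'" "bcf_mult (*) g g'"] N_mult[of f f'] N_mult[of g g']
        by (simp add: A_mult)
      moreover have "N (bcf_mult (*) f g' + bcf_mult (*) g f') \<le> N f * N g' + N g * N f'"
        using fg N_add[of "bcf_mult (*) f g'" "bcf_mult (*) g f'"] N_mult[of f g'] N_mult[of g f']
        by (simp add: A_mult)
      ultimately show "q (x * y) \<le> q x * q y"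
        unfolding eq mult[OF fg(1,2)] using fg
        by (simp add: q A_mult A_add A_diff) (simp add: algebra_simps)
      assume "q x = 0"
      then have "N f = 0" "N g = 0" using fg N_nonneg[of f] N_nonneg[of g] by (simp_all add: q)
      then have "f = 0" "g = 0" using fg N_eq_0 by blast+
      then show "x = 0" unfolding eq by (simp add: c_def fun_eq_iff)
    next
      fix u :: "nat \<Rightarrow> 'x \<Rightarrow> complex"
      assume u: "\<And>n. u n \<in> R" and Cauchy: "\<And>e. e > 0 \<Longrightarrow> \<exists>M. \<forall>m\<ge>M. \<forall>n\<ge>M. q (u m - u n) < e"
      have "\<forall>n. \<exists>f g. f \<in> A \<and> g \<in> A \<and> u n = c f g" using R_cases[OF u] by blast
      then obtain f g where fg: "\<And>n. f n \<in> A" "\<And>n. g n \<in> A" "\<And>n. u n = c (f n) (g n)" by metis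
      have q_u: "q (u m - c f' g') = N (f m - f') + N (g m - g')" if "f' \<in> A" "g' \<in> A" for m f' g'
        unfolding fg(3) diff by (intro q A_diff fg that)
      have le: "N (f m - f n) \<le> q (u m - u n)" "N (g m - g n) \<le> q (u m - u n)" for m n
        using N_nonneg[of "f m - f n"] N_nonneg[of "g m - g n"] by (simp_all add: fg(1,2) A_diff q_u fg(3)[of n])
      obtain f' where f': "f' \<in> A" "(\<lambda>n. N (f n - f')) \<longlonglongrightarrow> 0"
        using N_complete[of f] fg(1) Cauchy le(1) by (meson order_le_less_trans)
      obtain g' where g': "g' \<in> A" "(\<lambda>n. N (g n - g')) \<longlonglongrightarrow> 0"
        using N_complete[of g] fg(2) Cauchy le(2) by (meson order_le_less_trans)
      have "(\<lambda>n. q (u n - c f' g')) \<longlonglongrightarrow> 0"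
        using tendsto_add[OF f'(2) g'(2)] by (simp add: q_u f' g')
      then show "\<exists>x\<in>R. (\<lambda>n. q (u n - x)) \<longlonglongrightarrow> 0" using R_I f' g' by blast
    next
      fix z :: complex
      have A: "const_bcontfun (of_real r) \<in> A" for r by (intro A_const K_of_real)
      show "(\<lambda>_. z) \<in> R" using A by (rule R_I[OF _ _ const]) (rule A)
      have "q (\<lambda>_. z) = \<bar>Re z\<bar> * N1 + \<bar>Im z\<bar> * N1"
        by (subst const) (simp add: q A N_const K_of_real N1_def)
      also have "\<dots> \<le> cmod z * N1 + cmod z * N1"
        using N1 by (intro add_mono mult_right_mono abs_Re_le_cmod abs_Im_le_cmod)
      finally show "q (\<lambda>_. z) \<le> 2 * N1 * cmod z" by simp
    qed (simp_all add: fun_eq_iff)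
    interpret complex_banach_ring R "\<lambda>c _. c" q "2 * N1" by (rule ring)
    \<comment> \<open>The complexification of \<open>I\<close>; it stays proper because the real
      part of a representation of 1 would be the constant 1 in \<open>I\<close>.\<close>
    define J where "J = {c f g | f g. f \<in> I \<and> g \<in> I}"
    have J_cases: "\<exists>f\<in>I. \<exists>g\<in>I. x = c f g" if "x \<in> J" for x using that by (auto simp: J_def)
    have J_I: "x \<in> J" if "f \<in> I" "g \<in> I" "x = c f g" for x f g using that by (auto simp: J_def)
    have IA: "f \<in> A" if "f \<in> I" for f using that I(1) by blast
    have neg: "- f \<in> I" if "f \<in> I" for f
    proof -
      have "bcf_mult (*) (const_bcontfun (of_real (- 1))) f = - f"
        by (intro bcontfun_eqI) (simp add: apply_mult A_const K_of_real const_apply del: of_real_minus, simp)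
      then show ?thesis using I(4)[OF A_const[OF K_of_real[of "- 1"]] that] by simp
    qed
    have zero: "c 0 0 = 0" by (simp add: c_def fun_eq_iff)
    have emb: "apply_bcontfun f = c f 0" for f by (simp add: c_def)
    show ?thesis
    proof (rule *[OF ring])
      show "apply_bcontfun ` A \<subseteq> R"
        using R_I[OF _ A_zero emb] by blast
      show "ring_ideal J"
      proof (rule ring_idealI)
        show "J \<subseteq> R" unfolding J_def R_def using IA by blast
        show "0 \<in> J" using J_I[OF I(2) I(2)] zero by simp
        show "x + y \<in> J" if xy: "x \<in> J" "y \<in> J" for x y
        proof -
          obtain f g f' g' where fg: "f \<in> I" "g \<in> I" "x = c f g" "f' \<in> I" "g' \<in> I" "y = c f' g'"
            using J_cases xy by metis
          show ?thesis unfolding fg(3,6) add by (intro J_I[OF _ _ refl] I(3) fg)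
        qed
        show "x * y \<in> J" if xy: "x \<in> R" "y \<in> J" for x y
        proof -
          obtain f g f' g' where fg: "f \<in> A" "g \<in> A" "x = c f g" "f' \<in> I" "g' \<in> I" "y = c f' g'"
            using R_cases[OF xy(1)] J_cases[OF xy(2)] by metis
          then have "bcf_mult (*) f f' + - bcf_mult (*) g g' \<in> I" "bcf_mult (*) f g' + bcf_mult (*) g f' \<in> I"
            by (simp_all only: I(3) I(4) neg)
          then show ?thesis unfolding fg(3,6) mult[OF fg(1,2)] by (intro J_I[OF _ _ refl]) simp_all
        qed
      qed
      show "1 \<notin> J"
      proof
        assume "1 \<in> J"
        then obtain f g where fg: "f \<in> I" "g \<in> I" "1 = c f g" using J_cases by metis
        then have "f = const_bcontfun 1"
          using c_Re[of f g] IA by (intro bcontfun_eqI) (simp add: const_apply flip: fg(3))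
        then show False using proper fg by simp
      qed
      show "apply_bcontfun ` I \<subseteq> J"
        using J_I[OF _ I(2) emb] by blast
    qed
  qed
qed

section \<open>Point evaluations in the maximal ideal space\<close>

definition eval :: "'x \<Rightarrow> ('x \<Rightarrow>\<^sub>C complex) \<Rightarrow> complex" where
  "eval x = restrict (\<lambda>f. apply_bcontfun f x) A"

lemma eval_character: "eval x \<in> characters K A"
  unfolding eval_def by (rule characterI[of UNIV "\<lambda>f. f x"]) auto

lemma topspace_maximal_ideal_space: "topspace (maximal_ideal_space K A) = characters K A"
  unfolding maximal_ideal_space_def
  by (auto simp: PiE_def characters_def)

text \<open>Regularity speaks of closed sets of characters. Compactness of \<open>X\<close> and the
  Hausdorff property of pointwise convergence make the closed subsets of \<open>X\<close> available
  as such sets.\<close>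

lemma closedin_eval_image:
  assumes "closed S"
  shows "closedin (maximal_ideal_space K A) (eval ` S)"
proof (rule compactin_imp_closedin)
  show "Hausdorff_space (maximal_ideal_space K A)"
    unfolding maximal_ideal_space_def
    by (intro Hausdorff_space_subtopology) (simp add: Hausdorff_space_product_topology)
  have "continuous_map euclidean (product_topology (\<lambda>_. euclidean) A) eval"
    unfolding continuous_map_componentwise
    by (auto simp: eval_def continuous_map_iff_continuous2 intro: continuous_on_apply_bcontfun)
  then have "continuous_map euclidean (maximal_ideal_space K A) eval"
    unfolding maximal_ideal_space_def
    by (simp add: continuous_map_in_subtopology eval_character image_subset_iff)
  moreover have "compact S" using compact_Int_closed[OF compact assms] by simp
  ultimately show "compactin (maximal_ideal_space K A) (eval ` S)"
    by (intro image_compactin[of euclidean]) (simp_all add: compactin_euclidean_iff)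
qed

lemma character_eq_eval:
  assumes "\<psi> \<in> characters K A"
  obtains x where "\<psi> = eval x"
proof -
  have "\<psi> \<in> range eval"
  proof (rule ccontr)
    assume "\<psi> \<notin> range eval"
    with regular closedin_eval_image[of UNIV] assms obtain f where
      f: "f \<in> A" "\<psi> f = 1" "\<forall>\<omega>\<in>range eval. \<omega> f = 0"
      unfolding regular_algebra_def topspace_maximal_ideal_space gelfand_def by blast
    then have "apply_bcontfun f x = 0" for x by (auto simp: eval_def)
    then have "f = 0" by (intro bcontfun_eqI) simp
    moreover have "\<psi> (0 + 0) = \<psi> 0 + \<psi> 0"
      using assms A_zero unfolding characters_def linear_over_def by blast
    ultimately show False using f by simp
  qed
  then show ?thesis using that by blast
qed

theorem ideal_common_zero:
  assumes "I \<subseteq> A" "0 \<in> I" "\<And>f g. f \<in> I \<Longrightarrow> g \<in> I \<Longrightarrow> f + g \<in> I"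
      "\<And>f g. f \<in> A \<Longrightarrow> g \<in> I \<Longrightarrow> bcf_mult (*) f g \<in> I" "const_bcontfun 1 \<notin> I"
  obtains x where "\<And>f. f \<in> I \<Longrightarrow> apply_bcontfun f x = 0"
proof -
  obtain \<psi> where \<psi>: "\<psi> \<in> characters K A" "\<forall>f\<in>I. \<psi> f = 0"
    using ideal_in_character_kernel[OF assms] by blast
  moreover obtain x where "\<psi> = eval x" using character_eq_eval[OF \<psi>(1)] .
  ultimately show ?thesis using that[of x] assms(1) by (force simp: eval_def)
qed

text \<open>As \<open>A\<close> separates points, \<open>eval\<close> is injective, so a point
  outside \<open>S\<close> gives a character outside the image of \<open>S\<close>, to which
  regularity applies.\<close>

lemma regular_on_points:
  assumes "closed S" "x \<notin> S"
  obtains f where "f \<in> A" "apply_bcontfun f x = 1" "\<And>z. z \<in> S \<Longrightarrow> apply_bcontfun f z = 0"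
proof -
  have "eval x \<notin> eval ` S"
  proof
    assume "eval x \<in> eval ` S"
    then obtain z where z: "z \<in> S" "eval x = eval z" by blast
    then have "x \<noteq> z" using assms by blast
    moreover have "\<forall>x y. x \<noteq> y \<longrightarrow> (\<exists>f\<in>A. apply_bcontfun f x \<noteq> apply_bcontfun f y)"
      using algebra unfolding banach_function_algebra_def by (elim conjE)
    ultimately obtain f where f: "f \<in> A" "apply_bcontfun f x \<noteq> apply_bcontfun f z" by blast
    then show False using fun_cong[OF z(2), of f] by (simp add: eval_def)
  qed
  with regular closedin_eval_image[OF assms(1)] eval_character[of x] obtain f where
    "f \<in> A" "eval x f = 1" "\<forall>\<omega>\<in>eval ` S. \<omega> f = 0"
    unfolding regular_algebra_def topspace_maximal_ideal_space gelfand_def by blast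
  then show ?thesis using that[of f] by (auto simp: eval_def)
qed

end

subsection \<open>Jointly separating operators\<close>

lemma zero_in_dual_over: "(\<lambda>_. 0) \<in> dual_over K sc" if "K = \<real> \<or> K = UNIV"
  using that by (auto simp: dual_over_def linear_over_def)

lemma continuous_map_dual_over:
  assumes "l \<in> dual_over K sc"
  shows "continuous_map (weak_topology K sc) euclidean l"
proof -
  have "openin (weak_topology K sc) (l -` U)" if "open U" for U
    unfolding weak_topology_def using assms that by (intro topology_generated_by_Basis) blast
  from this[of UNIV] this show ?thesis
    by (auto simp: continuous_map_def vimage_def Collect_conj_eq Int_absorb1 dest: openin_subset)
qed

lemma continuous_map_weak_topology:
  fixes sc :: "complex \<Rightarrow> 'f::banach \<Rightarrow> 'f"
  assumes "K = \<real> \<or> K = UNIV" and f: "continuous_map Z euclidean f"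
  shows "continuous_map Z (weak_topology K sc) f"
  unfolding weak_topology_def
proof (rule continuous_on_generated_topo)
  fix V assume "V \<in> {l -` U | l U. l \<in> dual_over K sc \<and> open U}"
  then obtain l U where V: "V = l -` U" "l \<in> dual_over K sc" "open U" by blast
  then have "open V" by (auto simp: dual_over_def intro: open_vimage)
  then show "openin Z (f -` V \<inter> topspace Z)"
    using openin_continuous_map_preimage[OF f, of V] by (simp add: vimage_def Int_def conj_commute)
next
  \<comment> \<open>The underlying set of a generated topology is the union of its generators; the
    zero functional shows that it is the whole space.\<close>
  have "UNIV \<in> {l -` U | l U. l \<in> dual_over K sc \<and> open U}"
    using zero_in_dual_over[OF assms(1), of sc] by (auto intro!: exI[of _ "\<lambda>_. 0"] exI[of _ UNIV])
  then show "f ` topspace Z \<subseteq> \<Union> {l -` U | l U. l \<in> dual_over K sc \<and> open U}" by blast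
qed

lemma continuous_on_const_bcontfun: "continuous_on UNIV const_bcontfun"
proof (rule continuous_onI)
  fix a :: 'a and e :: real assume e: "0 < e"
  have "dist (const_bcontfun a' :: 'b \<Rightarrow>\<^sub>C 'a) (const_bcontfun a) \<le> dist a' a" for a'
    by (rule dist_bound) simp
  then have "\<forall>a'\<in>UNIV. dist a' a < e \<longrightarrow> dist (const_bcontfun a' :: 'b \<Rightarrow>\<^sub>C 'a) (const_bcontfun a) \<le> e"
    by (meson less_imp_le order_trans)
  with e show "\<exists>d>0. \<forall>a'\<in>UNIV. dist a' a < d \<longrightarrow> dist (const_bcontfun a' :: 'b \<Rightarrow>\<^sub>C 'a) (const_bcontfun a) \<le> e"
    by blast
qed

lemma continuous_on_bcontfun_eval: "continuous_on UNIV (\<lambda>f. apply_bcontfun f y)"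
proof (rule continuous_onI)
  fix f :: "'a \<Rightarrow>\<^sub>C 'b" and e :: real assume e: "0 < e"
  have "dist (g y) (f y) \<le> dist g f" for g :: "'a \<Rightarrow>\<^sub>C 'b" by (rule dist_bounded)
  then have "\<forall>g\<in>UNIV. dist g f < e \<longrightarrow> dist (apply_bcontfun g y) (f y) \<le> e"
    by (meson less_imp_le order_trans)
  with e show "\<exists>d>0. \<forall>g\<in>UNIV. dist g f < d \<longrightarrow> dist (apply_bcontfun g y) (f y) \<le> e" by blast
qed

lemma separate_point_compact:
  fixes x :: "'a::t2_space"
  assumes "compact C" "x \<notin> C"
  obtains U V where "open U" "open V" "x \<in> U" "C \<subseteq> V" "U \<inter> V = {}"
proof -
  have "Hausdorff_space (euclidean :: 'a topology)"
    unfolding Hausdorff_space_def using hausdorff by (fastforce simp: disjnt_def)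
  then obtain U V where "openin euclidean U" "openin euclidean V" "{x} \<subseteq> U" "C \<subseteq> V" "disjnt U V"
    using Hausdorff_space_compact_separation[of euclidean "{x}" C] assms
    by (metis compactin_euclidean_iff compact_sing disjnt_empty1 disjnt_insert1)
  then show ?thesis using that by (auto simp: disjnt_def)
qed

locale separating_pair = regular_function_algebra K AX
  for K and AX :: "('x::t2_space \<Rightarrow>\<^sub>C complex) set" +
  fixes scE :: "complex \<Rightarrow> 'e::banach \<Rightarrow> 'e" and scF :: "complex \<Rightarrow> 'f::banach \<Rightarrow> 'f"
    and AXE :: "('x \<Rightarrow>\<^sub>C 'e) set" and T S :: "('x \<Rightarrow>\<^sub>C 'e) \<Rightarrow> ('y::t2_space \<Rightarrow>\<^sub>C 'f)"
  assumes E: "banach_space_over K scE"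
    and F: "banach_space_over K scF"
    and AXE: "subspace_over K (bcf_scale scE) AXE"
    and AXE_const: "\<And>e. const_bcontfun e \<in> AXE"
    and module: "{bcf_mult scE f h | f h. f \<in> AX \<and> h \<in> AXE} \<subseteq> AXE"
    and P: "property_P norm AXE"
    and T: "linear_over K (bcf_scale scE) (bcf_scale scF) AXE T"
    and S: "linear_over K (bcf_scale scE) (bcf_scale scF) AXE S"
    and sep: "jointly_separating AXE T S"
begin

lemma add_scE: "c \<in> K \<Longrightarrow> d \<in> K \<Longrightarrow> scE (c + d) v = scE c v + scE d v"
  and scE_scE: "c \<in> K \<Longrightarrow> d \<in> K \<Longrightarrow> scE c (scE d v) = scE (c * d) v"
  and scE_of_real: "scE (of_real r) v = r *\<^sub>R v"
  using E by (auto simp: banach_space_over_def)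

lemma scE_0: "scE 0 v = 0" using scE_of_real[of 0 v] by simp

lemma scE_1: "scE 1 v = v" using scE_of_real[of 1 v] by simp

lemma apply_module: "f \<in> AX \<Longrightarrow> apply_bcontfun (bcf_mult scE f h) x = scE (f x) (h x)"
  using apply_bcf_mult[OF K E A_range] .

lemma module_closed: "f \<in> AX \<Longrightarrow> h \<in> AXE \<Longrightarrow> bcf_mult scE f h \<in> AXE"
  using module by blast

lemma AXE_add: "f \<in> AXE \<Longrightarrow> g \<in> AXE \<Longrightarrow> f + g \<in> AXE"
  and AXE_scale: "c \<in> K \<Longrightarrow> f \<in> AXE \<Longrightarrow> bcf_scale scE c f \<in> AXE"
  using AXE by (auto simp: subspace_over_def)

lemma AXE_uminus: "f \<in> AXE \<Longrightarrow> - f \<in> AXE"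
proof -
  assume "f \<in> AXE"
  moreover have "bcf_scale scE (of_real (- 1)) f = - f"
    by (intro bcontfun_eqI) (simp only: apply_bcf_scale[OF K E K_of_real] scE_of_real, simp)
  ultimately show ?thesis using AXE_scale[OF K_of_real[of "- 1"]] by metis
qed

lemma AXE_diff: "f \<in> AXE \<Longrightarrow> g \<in> AXE \<Longrightarrow> f - g \<in> AXE"
  using AXE_add[of f "- g"] AXE_uminus by simp

lemma T_add: "f \<in> AXE \<Longrightarrow> g \<in> AXE \<Longrightarrow> T (f + g) = T f + T g"
  and T_scale: "c \<in> K \<Longrightarrow> f \<in> AXE \<Longrightarrow> T (bcf_scale scE c f) = bcf_scale scF c (T f)"
  using T by (auto simp: linear_over_def)

lemma T_diff: "f \<in> AXE \<Longrightarrow> g \<in> AXE \<Longrightarrow> T (f - g) = T f - T g"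
  using T_add[of "f - g" g] AXE_diff by simp

lemma T_0: "T 0 = 0"
  using T_diff[of 0 0] AXE by (auto simp: subspace_over_def)

text \<open>The hypotheses are symmetric in the two operators, so whatever is proved for
  \<open>T\<close> becomes available for \<open>S\<close> under the prefix
  \<open>swap\<close>.\<close>

lemma separating_pair_swap: "separating_pair K AX scE scF AXE S T"
proof
  show "jointly_separating AXE S T" using sep unfolding jointly_separating_def by blast
qed (fact E F AXE AXE_const module P T S)+

section \<open>Null ideals and the support map\<close>

definition null_ideal :: "'y \<Rightarrow> ('x \<Rightarrow>\<^sub>C complex) set" where
  "null_ideal y = {f \<in> AX. \<forall>h\<in>AXE. apply_bcontfun (T (bcf_mult scE f h)) y = 0}"

lemma null_ideal_common_zero:
  assumes "h \<in> AXE" "apply_bcontfun (T h) y \<noteq> 0"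
  obtains x where "\<And>f. f \<in> null_ideal y \<Longrightarrow> apply_bcontfun f x = 0"
proof (rule ideal_common_zero)
  show "null_ideal y \<subseteq> AX" by (auto simp: null_ideal_def)
  have "bcf_mult scE 0 h = 0" for h :: "'x \<Rightarrow>\<^sub>C 'e"
    by (intro bcontfun_eqI) (simp add: apply_module A_zero scE_0)
  then show "0 \<in> null_ideal y" by (simp add: null_ideal_def A_zero T_0)
next
  fix f g assume fg: "f \<in> null_ideal y" "g \<in> null_ideal y"
  then have "f \<in> AX" "g \<in> AX" by (auto simp: null_ideal_def)
  moreover from this have "bcf_mult scE (f + g) h = bcf_mult scE f h + bcf_mult scE g h" for h
    by (intro bcontfun_eqI) (simp add: apply_module A_add A_vals add_scE)
  ultimately show "f + g \<in> null_ideal y"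
    using fg by (simp add: null_ideal_def A_add T_add module_closed)
next
  fix f g assume f: "f \<in> AX" and g: "g \<in> null_ideal y"
  then have gA: "g \<in> AX" by (auto simp: null_ideal_def)
  \<comment> \<open>The factor \<open>f\<close> is absorbed into \<open>h\<close>; for this the
    definition of \<open>null_ideal\<close> quantifies over all of \<open>AXE\<close>.\<close>
  have "bcf_mult scE (bcf_mult (*) f g) h = bcf_mult scE g (bcf_mult scE f h)" for h
    using f gA by (intro bcontfun_eqI) (simp add: apply_module A_mult apply_mult A_vals scE_scE mult.commute)
  then show "bcf_mult (*) f g \<in> null_ideal y"
    using f g by (simp add: null_ideal_def A_mult module_closed)
next
  have "bcf_mult scE (const_bcontfun 1) h = h"
    using A_const[OF K_of_real[of 1]] by (intro bcontfun_eqI) (simp add: apply_module scE_1)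
  then show "const_bcontfun 1 \<notin> null_ideal y"
    using assms by (auto simp: null_ideal_def intro!: bexI[of _ h])
qed (use that in blast)

lemma separation:
  assumes "f \<in> AXE" "g \<in> AXE" "\<And>x. f x = 0 \<or> g x = 0"
  shows "T f y = 0 \<or> S g y = 0"
proof -
  have "coz (apply_bcontfun f) \<inter> coz (apply_bcontfun g) = {}" using assms(3) by (auto simp: coz_def)
  then have "coz (apply_bcontfun (T f)) \<inter> coz (apply_bcontfun (S g)) = {}"
    using sep assms unfolding jointly_separating_def by blast
  then show ?thesis by (auto simp: coz_def)
qed

sublocale swap: separating_pair K AX scE scF AXE S T
  by (rule separating_pair_swap)

text \<open>The first condition provides products whose image under \<open>T\<close> is nonzero at
  \<open>y\<close>, as needed for the continuity of \<open>\<phi>\<close>; the second leads to the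
  representation of both operators.\<close>

definition support_point :: "'y \<Rightarrow> 'x \<Rightarrow> bool" where
  "support_point y x \<longleftrightarrow> (\<forall>f\<in>null_ideal y. apply_bcontfun f x = 0) \<and>
    (\<forall>f\<in>AXE. \<forall>U. open U \<and> x \<in> U \<and> (\<forall>z\<in>U. apply_bcontfun f z = 0) \<longrightarrow> T f y = 0 \<and> S f y = 0)"

lemma exists_support_point:
  assumes "y \<in> Y1 AXE T S"
  shows "\<exists>x. support_point y x"
proof -
  from assms obtain h k where "h \<in> AXE" "T h y \<noteq> 0" "k \<in> AXE" "S k y \<noteq> 0"
    by (auto simp: Y1_def coz_def)
  then obtain x x' where x: "\<And>f. f \<in> null_ideal y \<Longrightarrow> apply_bcontfun f x = 0"
    and x': "\<And>f. f \<in> swap.null_ideal y \<Longrightarrow> apply_bcontfun f x' = 0"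
    using null_ideal_common_zero[of h y] swap.null_ideal_common_zero[of k y] by metis
  have bump: "\<exists>b\<in>AX. apply_bcontfun b z = 1 \<and> (\<forall>w. w \<notin> U \<longrightarrow> b w = 0)" if "open U" "z \<in> U" for z U
    using regular_on_points[of "- U" z] that by (metis Compl_iff closed_Compl)
  \<comment> \<open>A bump at \<open>x\<close> inside \<open>U\<close> is not in the null ideal of
    \<open>T\<close>, so some \<open>T (bcf_mult scE b h)\<close> is nonzero at \<open>y\<close>.
    Every \<open>bcf_mult scE f k\<close> has a cozero set disjoint from that of
    \<open>bcf_mult scE b h\<close>, which forces its image under \<open>S\<close> to vanish at
    \<open>y\<close>.\<close>
  have near: "f \<in> swap.null_ideal y" if f: "f \<in> AX" and U: "open U" "x \<in> U" "\<And>z. z \<in> U \<Longrightarrow> f z = 0" for f U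
  proof -
    obtain b where b: "b \<in> AX" "apply_bcontfun b x = 1" "\<And>w. w \<notin> U \<Longrightarrow> b w = 0"
      using bump[OF U(1,2)] by blast
    have "b \<notin> null_ideal y" using x[of b] b(2) by auto
    then obtain h where h: "h \<in> AXE" "T (bcf_mult scE b h) y \<noteq> 0" using b(1) by (auto simp: null_ideal_def)
    have "S (bcf_mult scE f k) y = 0" if "k \<in> AXE" for k
      using separation[of "bcf_mult scE b h" "bcf_mult scE f k" y] h that f b U
      by (metis apply_module module_closed scE_0)
    then show ?thesis using f by (simp add: swap.null_ideal_def)
  qed
  \<comment> \<open>Otherwise a bump at \<open>x'\<close> vanishing near \<open>x\<close> would lie
    in the null ideal of \<open>S\<close> without vanishing at \<open>x'\<close>.\<close>
  have "x' = x"
  proof (rule ccontr)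
    assume "x' \<noteq> x"
    then obtain U V where UV: "open U" "open V" "x \<in> U" "x' \<in> V" "U \<inter> V = {}"
      using hausdorff[of x x'] by auto
    obtain b where b: "b \<in> AX" "apply_bcontfun b x' = 1" "\<And>w. w \<notin> V \<Longrightarrow> b w = 0"
      using bump[OF UV(2,4)] by blast
    have "b \<in> swap.null_ideal y" by (rule near[OF b(1) UV(1,3)]) (use b(3) UV in blast)
    then show False using x' b(2) by force
  qed
  have "T f y = 0 \<and> S f y = 0" if f: "f \<in> AXE" and U: "open U" "x \<in> U" "\<And>z. z \<in> U \<Longrightarrow> f z = 0" for f U
  proof -
    obtain b where b: "b \<in> AX" "apply_bcontfun b x = 1" "\<And>w. w \<notin> U \<Longrightarrow> b w = 0"
      using bump[OF U(1,2)] by blast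
    have disj: "apply_bcontfun (bcf_mult scE b h) z = 0 \<or> f z = 0" for h z
      using b U by (metis apply_module scE_0)
    \<comment> \<open>As the two points coincide, one bump serves both operators: its products are
      disjoint from \<open>f\<close>, and separation is used in either order.\<close>
    have "b \<notin> null_ideal y" "b \<notin> swap.null_ideal y" using x[of b] x'[of b] \<open>x' = x\<close> b(2) by auto
    then obtain h k where hk: "h \<in> AXE" "T (bcf_mult scE b h) y \<noteq> 0" "k \<in> AXE" "S (bcf_mult scE b k) y \<noteq> 0"
      using b(1) by (auto simp: null_ideal_def swap.null_ideal_def)
    show ?thesis
      using separation[of "bcf_mult scE b h" f y] swap.separation[of "bcf_mult scE b k" f y] hk disj f b(1)
      by (metis module_closed)
  qed
  then have "support_point y x" using x unfolding support_point_def by auto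
  then show ?thesis ..
qed

definition \<phi> :: "'y \<Rightarrow> 'x" where "\<phi> y = (SOME x. support_point y x)"

lemma support_point_\<phi>: "y \<in> Y1 AXE T S \<Longrightarrow> support_point y (\<phi> y)"
  unfolding \<phi>_def by (rule someI_ex[OF exists_support_point])

lemma vanish_near_\<phi>:
  assumes "y \<in> Y1 AXE T S" "f \<in> AXE" "open U" "\<phi> y \<in> U" "\<And>z. z \<in> U \<Longrightarrow> f z = 0"
  shows "T f y = 0" "S f y = 0"
  using support_point_\<phi>[OF assms(1)] assms(2-) unfolding support_point_def by blast+

text \<open>Vanishing on a neighbourhood of \<open>\<phi> y'\<close> is required to conclude that
  the image is 0 at \<open>y'\<close>. Hence the bump at \<open>\<phi> y\<close> must vanish on an
  open set \<open>V\<close> around the whole complement of \<open>B\<close>, not merely on the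
  complement, and a point has to be separated from a compact set.\<close>

lemma continuous_on_\<phi>: "continuous_on (Y1 AXE T S) \<phi>"
  unfolding continuous_on_topological
proof (intro ballI allI impI)
  fix y B assume y: "y \<in> Y1 AXE T S" and B: "open B" "\<phi> y \<in> B"
  have "compact (- B)" using compact_Int_closed[OF compact closed_Compl[OF B(1)]] by simp
  moreover have "\<phi> y \<notin> - B" using B(2) by simp
  ultimately obtain U V where U: "open U" and V: "open V" and U': "\<phi> y \<in> U" and V': "- B \<subseteq> V" "U \<inter> V = {}"
    by (rule separate_point_compact)
  obtain b where b: "b \<in> AX" "apply_bcontfun b (\<phi> y) = 1" "\<And>z. z \<in> - U \<Longrightarrow> b z = 0"
    using regular_on_points[of "- U" "\<phi> y"] U U' by auto
  have "b \<notin> null_ideal y"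
    using support_point_\<phi>[OF y] b(2) unfolding support_point_def by force
  then obtain h where h: "h \<in> AXE" "T (bcf_mult scE b h) y \<noteq> 0" using b(1) by (auto simp: null_ideal_def)
  define W where "W = apply_bcontfun (T (bcf_mult scE b h)) -` (- {0})"
  have "open W" unfolding W_def by (intro open_vimage) auto
  moreover have "y \<in> W" using h by (simp add: W_def)
  moreover have "\<phi> y' \<in> B" if y': "y' \<in> Y1 AXE T S" "y' \<in> W" for y'
  proof (rule ccontr)
    assume "\<phi> y' \<notin> B"
    then have "\<phi> y' \<in> V" using V' by blast
    moreover have "bcf_mult scE b h z = 0" if "z \<in> V" for z
    proof -
      have "b z = 0" using b(3)[of z] V'(2) that by blast
      then show ?thesis by (simp add: apply_module b(1) scE_0)
    qed
    ultimately have "T (bcf_mult scE b h) y' = 0"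
      using vanish_near_\<phi>(1)[OF y'(1) module_closed[OF b(1) h(1)] V] by blast
    then show False using y'(2) by (simp add: W_def)
  qed
  ultimately show "\<exists>W. open W \<and> y \<in> W \<and> (\<forall>y'\<in>Y1 AXE T S. y' \<in> W \<longrightarrow> \<phi> y' \<in> B)" by blast
qed

text \<open>Vanishing near \<open>x\<close> is assumed for an arbitrary \<open>x\<close>, so that
  the result, like \<open>T_eq_\<Lambda>\<close>, applies to \<open>S\<close> at the same point
  \<open>\<phi> y\<close> without comparing \<open>\<phi>\<close> with
  \<open>swap.\<phi>\<close>.\<close>

lemma weakly_continuous_null:
  assumes f: "f \<in> AXE" "apply_bcontfun f x = 0"
    and null: "\<And>g U. g \<in> AXE \<Longrightarrow> open U \<Longrightarrow> x \<in> U \<Longrightarrow> (\<And>z. z \<in> U \<Longrightarrow> apply_bcontfun g z = 0) \<Longrightarrow> T g y = 0"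
    and cont: "continuous_map (top_of_set AXE) (weak_topology K scF) (\<lambda>f. apply_bcontfun (T f) y)"
  shows "T f y = 0"
proof (rule ccontr)
  assume "T f y \<noteq> 0"
  then obtain l where l: "l \<in> dual_over K scF" "l (T f y) \<noteq> 0"
    using dual_over_separates[OF K F] by metis
  obtain u where u: "\<And>n. u n \<in> AXE" "\<And>n. \<exists>U. open U \<and> x \<in> U \<and> (\<forall>z\<in>U. apply_bcontfun (u n) z = 0)"
    "(\<lambda>n. norm (u n - f)) \<longlonglongrightarrow> 0"
    using P f unfolding property_P_def by metis
  have "u \<longlonglongrightarrow> f" using u(3) by (simp add: tendsto_norm_zero_iff LIM_zero_iff)
  moreover have "continuous_on AXE (\<lambda>f. l (T f y))"
    using continuous_map_compose[OF cont continuous_map_dual_over[OF l(1)]] by (simp add: comp_def)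
  ultimately have "(\<lambda>n. l (T (u n) y)) \<longlonglongrightarrow> l (T f y)"
    using f(1) u(1) by (intro continuous_on_tendsto_compose[of AXE "\<lambda>f. l (T f y)"]) auto
  moreover have "T (u n) y = 0" for n using u(1) u(2)[of n] null by metis
  moreover have "l (0 + 0) = l 0 + l 0" using l(1) unfolding dual_over_def linear_over_def by blast
  ultimately have "(\<lambda>n::nat. 0) \<longlonglongrightarrow> l (T f y)" by simp
  then show False using l(2) by (simp add: LIMSEQ_const_iff)
qed

section \<open>Representation through the values on constant functions\<close>

definition \<Lambda> :: "'y \<Rightarrow> 'e \<Rightarrow> 'f" where "\<Lambda> y e = T (const_bcontfun e) y"

lemma linear_\<Lambda>: "linear_over K scE scF UNIV (\<Lambda> y)"
proof -
  have "const_bcontfun (u + v) = (const_bcontfun u + const_bcontfun v :: 'x \<Rightarrow>\<^sub>C 'e)" for u v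
    by (intro bcontfun_eqI) simp
  moreover have "const_bcontfun (scE c v) = (bcf_scale scE c (const_bcontfun v) :: 'x \<Rightarrow>\<^sub>C 'e)" if "c \<in> K" for c v
    using that by (intro bcontfun_eqI) (simp add: apply_bcf_scale[OF K E])
  ultimately show ?thesis
    by (simp add: linear_over_def \<Lambda>_def T_add T_scale AXE_const apply_bcf_scale[OF K F])
qed

text \<open>Constants embed continuously into \<open>AXE\<close>. The topology \<open>\<tau>\<close>
  is left free so that one argument covers both the weak and the norm topology of
  \<open>F\<close>.\<close>

lemma \<Lambda>_continuous:
  assumes "continuous_map (top_of_set AXE) \<tau> (\<lambda>f. apply_bcontfun (T f) y)"
  shows "\<Lambda> y \<in> cont_linear_ops K scE scF \<tau>"
proof -
  have "continuous_map euclidean (top_of_set AXE) (const_bcontfun :: 'e \<Rightarrow> 'x \<Rightarrow>\<^sub>C 'e)"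
    using continuous_on_const_bcontfun AXE_const by (auto simp: continuous_map_in_subtopology)
  from continuous_map_compose[OF this assms] have "continuous_map euclidean \<tau> (\<Lambda> y)"
    by (simp add: \<Lambda>_def[abs_def] comp_def)
  then show ?thesis by (simp add: cont_linear_ops_def linear_\<Lambda>)
qed

lemma T_eq_\<Lambda>:
  assumes f: "f \<in> AXE"
    and null: "\<And>g U. g \<in> AXE \<Longrightarrow> open U \<Longrightarrow> x \<in> U \<Longrightarrow> (\<And>z. z \<in> U \<Longrightarrow> apply_bcontfun g z = 0) \<Longrightarrow> T g y = 0"
    and cont: "continuous_map (top_of_set AXE) (weak_topology K scF) (\<lambda>f. apply_bcontfun (T f) y)"
  shows "T f y = \<Lambda> y (f x)"
proof -
  have "T (f - const_bcontfun (f x)) y = 0"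
    by (rule weakly_continuous_null[OF _ _ null cont]) (simp_all add: AXE_diff f AXE_const)
  then show ?thesis by (simp add: T_diff f AXE_const \<Lambda>_def)
qed

lemma continuous_eval_T:
  assumes "continuous_on AXE T"
  shows "continuous_map (top_of_set AXE) euclidean (\<lambda>f. apply_bcontfun (T f) y)"
  using continuous_on_compose2[OF continuous_on_bcontfun_eval assms] by simp

end

theorem theorem4p3:
  fixes K :: "complex set"
    and scE :: "complex \<Rightarrow> 'e::banach \<Rightarrow> 'e"
    and scF :: "complex \<Rightarrow> 'f::banach \<Rightarrow> 'f"
    and AX :: "('x::t2_space \<Rightarrow>\<^sub>C complex) set"
    and AXE :: "('x \<Rightarrow>\<^sub>C 'e) set"
    and T S :: "('x \<Rightarrow>\<^sub>C 'e) \<Rightarrow> ('y::t2_space \<Rightarrow>\<^sub>C 'f)"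
  assumes K: "K = \<real> \<or> K = UNIV"
    and X: "compact (UNIV :: 'x set)"
    and Y: "compact (UNIV :: 'y set)"
    and E: "banach_space_over K scE"
    and F: "banach_space_over K scF"
    and AXE: "subspace_over K (bcf_scale scE) AXE"
    and AXE_const: "\<And>e. const_bcontfun e \<in> AXE"
    and AX: "banach_function_algebra K AX"
    and AX_regular: "regular_algebra K AX"
    and module: "{bcf_mult scE f h | f h. f \<in> AX \<and> h \<in> AXE} \<subseteq> AXE"
    and P: "property_P norm AXE"
    and T: "linear_over K (bcf_scale scE) (bcf_scale scF) AXE T"
    and S: "linear_over K (bcf_scale scE) (bcf_scale scF) AXE S"
    and sep: "jointly_separating AXE T S"
  shows "\<exists>(\<phi> :: 'y \<Rightarrow> 'x) (\<Lambda>T :: 'y \<Rightarrow> 'e \<Rightarrow> 'f) (\<Lambda>S :: 'y \<Rightarrow> 'e \<Rightarrow> 'f).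
    continuous_on (Yc K scF AXE T S \<union> Yd K scF AXE T S) \<phi> \<and>
    (\<forall>y\<in>Yc K scF AXE T S.
       \<Lambda>T y \<in> cont_linear_ops K scE scF (weak_topology K scF) \<and>
       \<Lambda>S y \<in> cont_linear_ops K scE scF (weak_topology K scF)) \<and>
    (\<forall>f\<in>AXE. \<forall>y\<in>Yc K scF AXE T S. T f y = \<Lambda>T y (f (\<phi> y)) \<and> S f y = \<Lambda>S y (f (\<phi> y))) \<and>
    (continuous_on AXE T \<and> continuous_on AXE S \<longrightarrow>
       Yd K scF AXE T S = {} \<and>
       Yc K scF AXE T S = Y1 AXE T S \<and>
       (\<forall>y\<in>Yc K scF AXE T S.
          \<Lambda>T y \<in> cont_linear_ops K scE scF euclidean \<and>
          \<Lambda>S y \<in> cont_linear_ops K scE scF euclidean) \<and>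
       ((\<exists>v::'f. v \<noteq> 0) \<and> range const_bcontfun \<subseteq> T ` AXE \<and> range const_bcontfun \<subseteq> S ` AXE \<longrightarrow>
          Yc K scF AXE T S = UNIV))"
proof -
  interpret separating_pair K AX scE scF AXE T S
    by unfold_locales (fact assms)+
  have Yc: "y \<in> Y1 AXE T S"
    "continuous_map (top_of_set AXE) (weak_topology K scF) (\<lambda>f. apply_bcontfun (T f) y)"
    "continuous_map (top_of_set AXE) (weak_topology K scF) (\<lambda>f. apply_bcontfun (S f) y)"
    if "y \<in> Yc K scF AXE T S" for y
    using that by (auto simp: Yc_def)
  show ?thesis
  proof (intro exI conjI ballI impI)
    have "Yc K scF AXE T S \<union> Yd K scF AXE T S = Y1 AXE T S" by (auto simp: Yc_def Yd_def)
    then show "continuous_on (Yc K scF AXE T S \<union> Yd K scF AXE T S) \<phi>" using continuous_on_\<phi> by simp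
  next
    fix y assume y: "y \<in> Yc K scF AXE T S"
    show "\<Lambda> y \<in> cont_linear_ops K scE scF (weak_topology K scF)"
      by (rule \<Lambda>_continuous[OF Yc(2)[OF y]])
    show "swap.\<Lambda> y \<in> cont_linear_ops K scE scF (weak_topology K scF)"
      by (rule swap.\<Lambda>_continuous[OF Yc(3)[OF y]])
  next
    fix f y assume f: "f \<in> AXE" and y: "y \<in> Yc K scF AXE T S"
    show "T f y = \<Lambda> y (f (\<phi> y))"
      by (rule T_eq_\<Lambda>[OF f vanish_near_\<phi>(1)[OF Yc(1)[OF y]] Yc(2)[OF y]])
    show "S f y = swap.\<Lambda> y (f (\<phi> y))"
      by (rule swap.T_eq_\<Lambda>[OF f vanish_near_\<phi>(2)[OF Yc(1)[OF y]] Yc(3)[OF y]])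
  next
    assume cont: "continuous_on AXE T \<and> continuous_on AXE S"
    note evT = continuous_eval_T[OF conjunct1[OF cont]] and evS = swap.continuous_eval_T[OF conjunct2[OF cont]]
    show eq: "Yc K scF AXE T S = Y1 AXE T S"
      using continuous_map_weak_topology[OF K evT] continuous_map_weak_topology[OF K evS]
      by (auto simp: Yc_def)
    then show "Yd K scF AXE T S = {}" by (simp add: Yd_def)
    show "\<Lambda> y \<in> cont_linear_ops K scE scF euclidean" for y by (rule \<Lambda>_continuous[OF evT])
    show "swap.\<Lambda> y \<in> cont_linear_ops K scE scF euclidean" for y by (rule swap.\<Lambda>_continuous[OF evS])
    assume "(\<exists>v::'f. v \<noteq> 0) \<and> range const_bcontfun \<subseteq> T ` AXE \<and> range const_bcontfun \<subseteq> S ` AXE"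
    \<comment> \<open>A nonzero constant attained by both operators places every \<open>y\<close> in
      both unions of cozero sets.\<close>
    then obtain v :: 'f and f g where v: "v \<noteq> 0" "f \<in> AXE" "T f = const_bcontfun v" "g \<in> AXE" "S g = const_bcontfun v"
      by (metis imageE range_subsetD)
    then have "y \<in> Y1 AXE T S" for y
      unfolding Y1_def coz_def
      by (intro IntI UN_I[of f] UN_I[of g]) simp_all
    then show "Yc K scF AXE T S = UNIV" using eq by auto
  qed
qed

end
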